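(* Let $(N,g)$ be an $(n+1)$-dimensional pseudo-Riemannian space form with scalar curvature $R_g$ and let $i:M\to N$ be an immersion of an $n$-dimensional hypersurface $M$ such that $h=i^*(g)$ is nondegenerate. Let $\Pi$ be the second fundamental form of the immersion $i$ defined with respect to a transverse vector field $Z$ along $i$ orthogonal to $i(M)$ and satisfying $\epsilon=|Z|_g^2\in\{\pm1\}$. If $g$ has constant curvature, with curvature tensor equal to $-\frac{R_g}{n(n+1)}\,g\circledast g$, and $i(M)$ has mean curvature zero, then $(h,\Pi)$ solves the coupled projectively flat equations with $c=-\epsilon$ and $\kappa=\mathrm{scal}+\epsilon|\Pi|^2=\frac{n-1}{n+1}R_g$, where $\mathrm{scal}$ is the scalar curvature of $h$.
   Context: Here $n \geq 2$. For a pseudo-Riemannian metric $h$ with Levi-Civita connection $D$, the curvature is defined by $D_iD_j\alpha_k-D_jD_i\alpha_k=-R_{ijk}{}^p\alpha_p$ for one-forms $\alpha$, $\mathrm{Riem}_{ijkl}=R_{ijk}{}^ph_{pl}$, $\mathrm{Ric}_{ij}=R_{pij}{}^p$, $\mathrm{scal}=h^{ij}\mathrm{Ric}_{ij}$. For symmetric two-tensors, $(\omega\circledast\omega)_{ijkl}=\omega_{ki}\omega_{jl}-\omega_{kj}\omega_{il}$ (so $(h\circledast h)_{ijkl}=h_{ki}h_{jl}-h_{kj}h_{il}$) and $|\omega|^2=\omega^{ij}\omega_{ij}$. The second fundamental form $\Pi$ with respect to $Z$ is the symmetric two-tensor on $M$ such that $\Pi(X,Y)Z$ is the projection of $\hat\nabla_XY$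 onto the normal direction, where $\hat\nabla$ is the Levi-Civita connection of $g$; mean curvature zero means $\mathrm{tr}_h\Pi=0$. A pair $(h,\omega)$ with $\omega$ a symmetric two-tensor solves the coupled projectively flat equations with constants $c,\kappa\in\mathbb{R}$ if $\omega$ is $h$-trace-free, $D_i\omega_{jk}=D_j\omega_{ik}$ (so that $\omega$ is Codazzi and divergence free), and $\mathrm{Riem}-c(\omega\circledast\omega)=-\frac{\kappa}{n(n-1)}h\circledast h$. *)

theory Defs
  imports "HOL-Analysis.Analysis"
begin

section \<open>Smooth functions between normed spaces\<close>

text \<open>Intended for open \<open>S\<close> and finite-dimensional domains, where it is the usual class \<open>C^k\<close>.\<close>

fun Ck_on :: "nat \<Rightarrow> 'v::real_normed_vector set \<Rightarrow> ('v \<Rightarrow> 'w::real_normed_vector) \<Rightarrow> bool" where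
  "Ck_on 0 S f \<longleftrightarrow> continuous_on S f"
| "Ck_on (Suc k) S f \<longleftrightarrow>
     (\<forall>x\<in>S. f differentiable (at x)) \<and> (\<forall>v. Ck_on k S (\<lambda>x. frechet_derivative f (at x) v))"

definition smooth_on :: "'v::real_normed_vector set \<Rightarrow> ('v \<Rightarrow> 'w::real_normed_vector) \<Rightarrow> bool" where
  "smooth_on S f \<longleftrightarrow> (\<forall>k. Ck_on k S f)"

definition pd :: "'n::finite \<Rightarrow> (real^'n \<Rightarrow> 'w::real_normed_vector) \<Rightarrow> real^'n \<Rightarrow> 'w" where
  "pd i f x = frechet_derivative f (at x) (axis i 1)"


section \<open>Smooth manifolds and smooth maps\<close>

text \<open>A chart is its domain together with its coordinate map; the dimension of the manifold is
  \<open>CARD('n)\<close>. Values of the coordinate map outside the domain are irrelevant.\<close>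

type_synonym ('a, 'n) chart = "'a set \<times> ('a \<Rightarrow> real^'n)"

abbreviation chart_dom :: "('a, 'n) chart \<Rightarrow> 'a set" where "chart_dom \<equiv> fst"
abbreviation coord :: "('a, 'n) chart \<Rightarrow> 'a \<Rightarrow> real^'n" where "coord \<equiv> snd"

definition chart_img :: "('a, 'n) chart \<Rightarrow> (real^'n) set" where
  "chart_img c = coord c ` chart_dom c"

definition param :: "('a, 'n) chart \<Rightarrow> real^'n \<Rightarrow> 'a" where
  "param c = inv_into (chart_dom c) (coord c)"

definition local_rep :: "('a, 'n) chart \<Rightarrow> ('b, 'm) chart \<Rightarrow> ('a \<Rightarrow> 'b) \<Rightarrow> real^'n \<Rightarrow> real^'m" where
  "local_rep c d f x = coord d (f (param c x))"

text \<open>The open set of coordinates on which \<open>local_rep c d f\<close> represents \<open>f\<close>.\<close>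

definition rep_dom :: "('a, 'n) chart \<Rightarrow> ('b, 'm) chart \<Rightarrow> ('a \<Rightarrow> 'b) \<Rightarrow> (real^'n) set" where
  "rep_dom c d f = coord c ` (chart_dom c \<inter> f -` chart_dom d)"

definition smooth_manifold :: "'a topology \<Rightarrow> ('a, 'n::finite) chart set \<Rightarrow> bool" where
  "smooth_manifold X A \<longleftrightarrow>
     Hausdorff_space X \<and> second_countable X \<and>
     (\<forall>c\<in>A. openin X (chart_dom c) \<and> open (chart_img c) \<and>
        homeomorphic_map (subtopology X (chart_dom c)) (top_of_set (chart_img c)) (coord c)) \<and>
     \<Union> (chart_dom ` A) = topspace X \<and>
     (\<forall>c\<in>A. \<forall>c'\<in>A. smooth_on (rep_dom c c' id) (local_rep c c' id))"

definition smooth_map :: "'a topology \<Rightarrow> ('a, 'n::finite) chart set \<Rightarrow> 'b topology \<Rightarrow>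
    ('b, 'm::finite) chart set \<Rightarrow> ('a \<Rightarrow> 'b) \<Rightarrow> bool" where
  "smooth_map X A Y B f \<longleftrightarrow> continuous_map X Y f \<and>
     (\<forall>c\<in>A. \<forall>d\<in>B. smooth_on (rep_dom c d f) (local_rep c d f))"

definition immersion :: "'a topology \<Rightarrow> ('a, 'n::finite) chart set \<Rightarrow> 'b topology \<Rightarrow>
    ('b, 'm::finite) chart set \<Rightarrow> ('a \<Rightarrow> 'b) \<Rightarrow> bool" where
  "immersion X A Y B f \<longleftrightarrow> smooth_map X A Y B f \<and>
     (\<forall>c\<in>A. \<forall>d\<in>B. \<forall>x\<in>rep_dom c d f. inj (frechet_derivative (local_rep c d f) (at x)))"


section \<open>Symmetric two-tensors\<close>

text \<open>A covariant two-tensor field \<open>T\<close> is given by its component matrices in every chart: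
  \<open>T c x $ i $ j\<close> is the \<open>(i, j)\<close> component in the chart \<open>c\<close> at the point with coordinates
  \<open>x \<in> chart_img c\<close>. The last conjunct of \<open>sym_tensor2\<close> is the transformation law
  \<open>T_ij = T'_ab (dy^a/dx^i) (dy^b/dx^j)\<close>.\<close>

type_synonym ('a, 'n) tensor2 = "('a, 'n) chart \<Rightarrow> real^'n \<Rightarrow> real^'n^'n"

definition sym_tensor2 :: "('a, 'n::finite) chart set \<Rightarrow> ('a, 'n) tensor2 \<Rightarrow> bool" where
  "sym_tensor2 A T \<longleftrightarrow>
     (\<forall>c\<in>A. smooth_on (chart_img c) (T c) \<and> (\<forall>x\<in>chart_img c. transpose (T c x) = T c x)) \<and>
     (\<forall>c\<in>A. \<forall>c'\<in>A. \<forall>x\<in>rep_dom c c' id.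
        T c x = transpose (jacobian (local_rep c c' id) (at x)) ** T c' (local_rep c c' id x)
                  ** jacobian (local_rep c c' id) (at x))"

definition nondegenerate :: "('a, 'n::finite) chart set \<Rightarrow> ('a, 'n) tensor2 \<Rightarrow> bool" where
  "nondegenerate A T \<longleftrightarrow> (\<forall>c\<in>A. \<forall>x\<in>chart_img c. invertible (T c x))"

definition pseudo_riemannian_metric :: "('a, 'n::finite) chart set \<Rightarrow> ('a, 'n) tensor2 \<Rightarrow> bool" where
  "pseudo_riemannian_metric A h \<longleftrightarrow> sym_tensor2 A h \<and> nondegenerate A h"

text \<open>The pullback \<open>f^*g\<close>. By the transformation law the choice of \<open>d\<close> is immaterial,
  see \<open>pullback_eq\<close> below.\<close>

definition pullback :: "('b, 'm::finite) chart set \<Rightarrow> ('a \<Rightarrow> 'b) \<Rightarrow> ('b, 'm) tensor2 \<Rightarrow>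
    ('a, 'n::finite) tensor2" where
  "pullback B f g c x =
     (let d = (SOME d. d \<in> B \<and> f (param c x) \<in> chart_dom d);
          J = jacobian (local_rep c d f) (at x)
      in transpose J ** g d (local_rep c d f x) ** J)"


section \<open>Levi-Civita connection and curvature in coordinates\<close>

text \<open>In this section \<open>h\<close> is the component matrix of a metric in one chart.
  \<open>christoffel h x i j k\<close> is the symbol with lower indices \<open>i\<close>, \<open>j\<close> and upper index \<open>k\<close>, i.e.
  \<open>D_i d_j = \<Gamma>_ij^k d_k\<close>; \<open>christoffel_iff_levi_civita\<close> below shows that these are exactly
  the coefficients of the torsion-free metric connection.\<close>

definition christoffel :: "(real^'n \<Rightarrow> real^'n^'n) \<Rightarrow> real^'n \<Rightarrow> 'n::finite \<Rightarrow> 'n \<Rightarrow> 'n \<Rightarrow> real" where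
  "christoffel h x i j k = (1/2) * (\<Sum>l\<in>UNIV. matrix_inv (h x) $ k $ l *
     (pd i (\<lambda>y. h y $ j $ l) x + pd j (\<lambda>y. h y $ i $ l) x - pd l (\<lambda>y. h y $ i $ j) x))"

text \<open>\<open>cov1 h \<alpha> x i k = D_i \<alpha>_k\<close> and \<open>cov2 h T x i j k = D_i T_jk\<close>.\<close>

definition cov1 :: "(real^'n \<Rightarrow> real^'n^'n) \<Rightarrow> (real^'n \<Rightarrow> real^'n) \<Rightarrow> real^'n \<Rightarrow>
    'n::finite \<Rightarrow> 'n \<Rightarrow> real" where
  "cov1 h \<alpha> x i k = pd i (\<lambda>y. \<alpha> y $ k) x - (\<Sum>p\<in>UNIV. christoffel h x i k p * \<alpha> x $ p)"

definition cov2 :: "(real^'n \<Rightarrow> real^'n^'n) \<Rightarrow> (real^'n \<Rightarrow> real^'n^'n) \<Rightarrow> real^'n \<Rightarrow>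
    'n::finite \<Rightarrow> 'n \<Rightarrow> 'n \<Rightarrow> real" where
  "cov2 h T x i j k = pd i (\<lambda>y. T y $ j $ k) x
     - (\<Sum>p\<in>UNIV. christoffel h x i j p * T x $ p $ k)
     - (\<Sum>p\<in>UNIV. christoffel h x i k p * T x $ j $ p)"

definition cov11 :: "(real^'n \<Rightarrow> real^'n^'n) \<Rightarrow> (real^'n \<Rightarrow> real^'n) \<Rightarrow> real^'n \<Rightarrow>
    'n::finite \<Rightarrow> 'n \<Rightarrow> 'n \<Rightarrow> real" where
  "cov11 h \<alpha> x i j k = cov2 h (\<lambda>y. \<chi> j k. cov1 h \<alpha> y j k) x i j k"

text \<open>\<open>curv h x i j k p\<close> is \<open>R_ijk^p\<close>, read off from
  \<open>D_i D_j \<alpha>_k - D_j D_i \<alpha>_k = - R_ijk^p \<alpha>_p\<close> at the coordinate one-form \<open>\<alpha> = dx^p\<close>; the identity for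
  all one-forms is \<open>ricci_identity\<close> below.\<close>

definition curv :: "(real^'n \<Rightarrow> real^'n^'n) \<Rightarrow> real^'n \<Rightarrow>
    'n::finite \<Rightarrow> 'n \<Rightarrow> 'n \<Rightarrow> 'n \<Rightarrow> real" where
  "curv h x i j k p = - (cov11 h (\<lambda>_. axis p 1) x i j k - cov11 h (\<lambda>_. axis p 1) x j i k)"

definition Riem :: "(real^'n \<Rightarrow> real^'n^'n) \<Rightarrow> real^'n \<Rightarrow>
    'n::finite \<Rightarrow> 'n \<Rightarrow> 'n \<Rightarrow> 'n \<Rightarrow> real" where
  "Riem h x i j k l = (\<Sum>p\<in>UNIV. curv h x i j k p * h x $ p $ l)"

definition Ric :: "(real^'n \<Rightarrow> real^'n^'n) \<Rightarrow> real^'n \<Rightarrow> 'n::finite \<Rightarrow> 'n \<Rightarrow> real" where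
  "Ric h x i j = (\<Sum>p\<in>UNIV. curv h x p i j p)"

definition scal :: "(real^'n::finite \<Rightarrow> real^'n^'n) \<Rightarrow> real^'n \<Rightarrow> real" where
  "scal h x = (\<Sum>i\<in>UNIV. \<Sum>j\<in>UNIV. matrix_inv (h x) $ i $ j * Ric h x i j)"

definition owedge :: "real^'n^'n \<Rightarrow> 'n::finite \<Rightarrow> 'n \<Rightarrow> 'n \<Rightarrow> 'n \<Rightarrow> real" where
  "owedge w i j k l = w $ k $ i * w $ j $ l - w $ k $ j * w $ i $ l"

definition trace_wrt :: "real^'n^'n \<Rightarrow> real^'n^'n \<Rightarrow> real" where
  "trace_wrt h w = (\<Sum>i\<in>UNIV. \<Sum>j\<in>UNIV. matrix_inv h $ i $ j * w $ i $ j)"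

definition sq_norm_wrt :: "real^'n::finite^'n \<Rightarrow> real^'n^'n \<Rightarrow> real" where
  "sq_norm_wrt h w = (\<Sum>i\<in>UNIV. \<Sum>j\<in>UNIV. \<Sum>a\<in>UNIV. \<Sum>b\<in>UNIV.
     matrix_inv h $ i $ a * matrix_inv h $ j $ b * w $ a $ b * w $ i $ j)"


section \<open>The coupled projectively flat equations\<close>

definition coupled_projectively_flat :: "('a, 'n::finite) chart set \<Rightarrow> ('a, 'n) tensor2 \<Rightarrow>
    ('a, 'n) tensor2 \<Rightarrow> real \<Rightarrow> real \<Rightarrow> bool" where
  "coupled_projectively_flat A h w c \<kappa> \<longleftrightarrow>
     pseudo_riemannian_metric A h \<and> sym_tensor2 A w \<and>
     (\<forall>u\<in>A. \<forall>x\<in>chart_img u.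
        trace_wrt (h u x) (w u x) = 0 \<and>
        (\<forall>i j k. cov2 (h u) (w u) x i j k = cov2 (h u) (w u) x j i k) \<and>
        (\<forall>i j k l. Riem (h u) x i j k l - c * owedge (w u x) i j k l
           = - (\<kappa> / (real CARD('n) * (real CARD('n) - 1))) * owedge (h u x) i j k l))"


section \<open>Vector fields along a map and the second fundamental form\<close>

text \<open>A vector field along \<open>f\<close> is given by its components \<open>Z d p\<close> at \<open>f p\<close> in every chart \<open>d\<close>
  of the target around \<open>f p\<close>.\<close>

definition vector_field_along :: "('a, 'n::finite) chart set \<Rightarrow> ('b, 'm::finite) chart set \<Rightarrow>
    ('a \<Rightarrow> 'b) \<Rightarrow> (('b, 'm) chart \<Rightarrow> 'a \<Rightarrow> real^'m) \<Rightarrow> bool" where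
  "vector_field_along A B f Z \<longleftrightarrow>
     (\<forall>c\<in>A. \<forall>d\<in>B. smooth_on (rep_dom c d f) (\<lambda>x. Z d (param c x))) \<and>
     (\<forall>p\<in>\<Union> (chart_dom ` A). \<forall>d\<in>B. \<forall>d'\<in>B. f p \<in> chart_dom d \<inter> chart_dom d' \<longrightarrow>
        Z d' p = frechet_derivative (local_rep d d' id) (at (coord d (f p))) (Z d p))"

definition metric_inner :: "real^'m^'m \<Rightarrow> real^'m \<Rightarrow> real^'m \<Rightarrow> real" where
  "metric_inner G v w = v \<bullet> (G *v w)"

definition transverse_along :: "('a, 'n::finite) chart set \<Rightarrow> ('b, 'm::finite) chart set \<Rightarrow>
    ('a \<Rightarrow> 'b) \<Rightarrow> (('b, 'm) chart \<Rightarrow> 'a \<Rightarrow> real^'m) \<Rightarrow> bool" where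
  "transverse_along A B f Z \<longleftrightarrow> (\<forall>c\<in>A. \<forall>d\<in>B. \<forall>x\<in>rep_dom c d f.
     Z d (param c x) \<notin> range (frechet_derivative (local_rep c d f) (at x)))"

definition orthogonal_along :: "('a, 'n::finite) chart set \<Rightarrow> ('b, 'm::finite) chart set \<Rightarrow>
    ('a \<Rightarrow> 'b) \<Rightarrow> ('b, 'm) tensor2 \<Rightarrow> (('b, 'm) chart \<Rightarrow> 'a \<Rightarrow> real^'m) \<Rightarrow> bool" where
  "orthogonal_along A B f g Z \<longleftrightarrow> (\<forall>c\<in>A. \<forall>d\<in>B. \<forall>x\<in>rep_dom c d f. \<forall>v.
     metric_inner (g d (local_rep c d f x)) (Z d (param c x))
       (frechet_derivative (local_rep c d f) (at x) v) = 0)"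

definition sq_length_along :: "('a, 'n::finite) chart set \<Rightarrow> ('b, 'm::finite) chart set \<Rightarrow>
    ('a \<Rightarrow> 'b) \<Rightarrow> ('b, 'm) tensor2 \<Rightarrow> (('b, 'm) chart \<Rightarrow> 'a \<Rightarrow> real^'m) \<Rightarrow> real \<Rightarrow> bool" where
  "sq_length_along A B f g Z e \<longleftrightarrow> (\<forall>c\<in>A. \<forall>d\<in>B. \<forall>x\<in>rep_dom c d f.
     metric_inner (g d (local_rep c d f x)) (Z d (param c x)) (Z d (param c x)) = e)"

text \<open>\<open>cov_along g F V x v\<close>: the derivative at \<open>x\<close>, in direction \<open>v\<close>, of the vector field \<open>V\<close>
  along \<open>F\<close> with respect to the Levi-Civita connection of \<open>g\<close>, all in coordinates:
  \<open>v^i (d_i V^e + \<Gamma>_ab^e(F x) d_i F^a V^b)\<close>.\<close>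

definition cov_along :: "(real^'m \<Rightarrow> real^'m^'m) \<Rightarrow> (real^'n::finite \<Rightarrow> real^'m::finite) \<Rightarrow>
    (real^'n \<Rightarrow> real^'m) \<Rightarrow> real^'n \<Rightarrow> real^'n \<Rightarrow> real^'m" where
  "cov_along g F V x v = frechet_derivative V (at x) v +
     (\<chi> e. \<Sum>a\<in>UNIV. \<Sum>b\<in>UNIV.
        christoffel g (F x) a b e * frechet_derivative F (at x) v $ a * V x $ b)"

text \<open>\<open>w\<close> is the normal component of \<open>v\<close> in the decomposition into a vector of the tangent
  space \<open>T\<close> and a vector orthogonal to it.\<close>

definition normal_projection :: "real^'m^'m \<Rightarrow> (real^'m) set \<Rightarrow> real^'m \<Rightarrow> real^'m \<Rightarrow> bool" where
  "normal_projection G T v w \<longleftrightarrow> v - w \<in> T \<and> (\<forall>t\<in>T. metric_inner G w t = 0)"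

text \<open>\<open>P\<close> is the symmetric two-tensor for which \<open>P(X, Y) Z\<close> is the normal part of the covariant
  derivative of \<open>df(Y)\<close> along \<open>X\<close>, for all local vector fields \<open>X\<close>, \<open>Y\<close>.\<close>

definition second_fundamental_form :: "('a, 'n::finite) chart set \<Rightarrow> ('b, 'm::finite) chart set \<Rightarrow>
    ('a \<Rightarrow> 'b) \<Rightarrow> ('b, 'm) tensor2 \<Rightarrow> (('b, 'm) chart \<Rightarrow> 'a \<Rightarrow> real^'m) \<Rightarrow>
    ('a, 'n) tensor2 \<Rightarrow> bool" where
  "second_fundamental_form A B f g Z P \<longleftrightarrow> sym_tensor2 A P \<and>
     (\<forall>c\<in>A. \<forall>d\<in>B. \<forall>X Y. smooth_on (rep_dom c d f) X \<longrightarrow> smooth_on (rep_dom c d f) Y \<longrightarrow>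
        (\<forall>x\<in>rep_dom c d f.
           let F = local_rep c d f in
           normal_projection (g d (F x)) (range (frechet_derivative F (at x)))
             (cov_along (g d) F (\<lambda>y. frechet_derivative F (at y) (Y y)) x (X x))
             (metric_inner (P c x) (X x) (Y x) *\<^sub>R Z d (param c x))))"


section \<open>The coordinate definitions have their characterising properties\<close>

lemma matrix_inv_both:
  fixes M :: "real^'n::finite^'n"
  assumes "invertible M" shows "M ** matrix_inv M = mat 1" "matrix_inv M ** M = mat 1"
  using someI_ex[OF assms[unfolded invertible_def]] unfolding matrix_inv_def by auto

lemma frechet_nth:
  fixes f :: "'v::real_normed_vector \<Rightarrow> real^'n"
  assumes "f differentiable (at x)"
  shows "frechet_derivative (\<lambda>y. f y $ k) (at x) v = frechet_derivative f (at x) v $ k"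
proof -
  have "(f has_derivative frechet_derivative f (at x)) (at x)"
    using assms frechet_derivative_works by blast
  then have "((\<lambda>y. f y $ k) has_derivative (\<lambda>v. frechet_derivative f (at x) v $ k)) (at x)"
    by (rule bounded_linear.has_derivative[OF bounded_linear_vec_nth])
  then show ?thesis by (metis frechet_derivative_at)
qed

lemma differentiable_nth:
  fixes f :: "'v::real_normed_vector \<Rightarrow> ('w::real_normed_vector)^'n"
  assumes "f differentiable (at x)"
  shows "(\<lambda>y. f y $ k) differentiable (at x)"
  using assms bounded_linear.has_derivative[OF bounded_linear_vec_nth] 
  unfolding differentiable_def by blast

lemma smooth_on_differentiable: "smooth_on S f \<Longrightarrow> x \<in> S \<Longrightarrow> f differentiable (at x)"
  unfolding smooth_on_def by (metis Ck_on.simps(2))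

lemma smooth_on_frechet: "smooth_on S f \<Longrightarrow> smooth_on S (\<lambda>x. frechet_derivative f (at x) v)"
  unfolding smooth_on_def by (metis Ck_on.simps(2))

lemma smooth_on_continuous: "smooth_on S f \<Longrightarrow> continuous_on S f"
  unfolding smooth_on_def by (metis Ck_on.simps(1))

lemma frechet_nth2:
  fixes f :: "'v::real_normed_vector \<Rightarrow> real^'n^'m"
  assumes "f differentiable (at x)"
  shows "frechet_derivative (\<lambda>y. f y $ k $ l) (at x) v = frechet_derivative f (at x) v $ k $ l"
proof -
  have "(f has_derivative frechet_derivative f (at x)) (at x)"
    using assms frechet_derivative_works by blast
  then have "((\<lambda>y. f y $ k $ l) has_derivative (\<lambda>v. frechet_derivative f (at x) v $ k $ l)) (at x)"
    by (intro bounded_linear.has_derivative[OF bounded_linear_vec_nth])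
  then show ?thesis by (metis frechet_derivative_at)
qed

lemma frechet_cong_open:
  assumes "open S" "x \<in> S" "\<And>y. y \<in> S \<Longrightarrow> f y = g y"
  shows "frechet_derivative f (at x) = frechet_derivative g (at x)"
proof -
  have "(f has_derivative D) (at x) \<longleftrightarrow> (g has_derivative D) (at x)" for D
    using assms has_derivative_transform_within_open[of _ D x UNIV S] by (metis)
  then show ?thesis unfolding frechet_derivative_def by simp
qed

lemma differentiable_cong_open:
  assumes "open S" "x \<in> S" "\<And>y. y \<in> S \<Longrightarrow> f y = g y" "f differentiable (at x)"
  shows "g differentiable (at x)"
  using assms has_derivative_transform_within_open[of f _ x UNIV S g]
  unfolding differentiable_def by blast

lemma christoffel_iff_levi_civita:
  fixes h :: "real^'n::finite \<Rightarrow> real^'n^'n" and G :: "'n \<Rightarrow> 'n \<Rightarrow> 'n \<Rightarrow> real"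
  assumes "open S" "x \<in> S" "\<And>y. y \<in> S \<Longrightarrow> transpose (h y) = h y" "invertible (h x)"
  shows "(\<forall>i j k. G i j k = christoffel h x i j k) \<longleftrightarrow>
     (\<forall>i j k. G i j k = G j i k) \<and>
     (\<forall>i j k. pd k (\<lambda>y. h y $ i $ j) x
        = (\<Sum>l\<in>UNIV. G k i l * h x $ l $ j) + (\<Sum>l\<in>UNIV. G k j l * h x $ i $ l))"
proof -
  have sym: "h y $ i $ j = h y $ j $ i" if "y \<in> S" for y i j
    using assms(3)[OF that] by (metis transpose_def vec_lambda_beta)
  have symx: "h x $ i $ j = h x $ j $ i" for i j using sym assms(2) by blast
  define d where "d k i j = pd k (\<lambda>y. h y $ i $ j) x" for k i j
  have dsym: "d k i j = d k j i" for k i j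
    unfolding d_def pd_def by (subst frechet_cong_open[OF assms(1,2) sym[of _ i j]]) auto
  define H where "H = matrix_inv (h x)"
  have inv: "H ** h x = mat 1" "h x ** H = mat 1"
    unfolding H_def using assms(4) matrix_inv_both by auto
  have inv1: "(\<Sum>l\<in>UNIV. H $ k $ l * h x $ l $ m) = (if k = m then 1 else 0)" for k m
    using arg_cong[OF inv(1), of "\<lambda>M. M $ k $ m"] by (simp add: matrix_matrix_mult_def mat_def)
  have inv2: "(\<Sum>l\<in>UNIV. h x $ k $ l * H $ l $ m) = (if k = m then 1 else 0)" for k m
    using arg_cong[OF inv(2), of "\<lambda>M. M $ k $ m"] by (simp add: matrix_matrix_mult_def mat_def)
  define K where "K i j l = (1/2) * (d i j l + d j i l - d l i j)" for i j l
  have chr: "christoffel h x i j k = (\<Sum>l\<in>UNIV. H $ k $ l * K i j l)" for i j k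
    unfolding christoffel_def K_def H_def d_def by (simp add: sum_distrib_left mult_ac)
  define L where "L i j l = (\<Sum>k\<in>UNIV. G i j k * h x $ k $ l)" for i j l
  have up: "G i j k = (\<Sum>l\<in>UNIV. H $ k $ l * L i j l)" for i j k
  proof -
    have "(\<Sum>l\<in>UNIV. H $ k $ l * L i j l) = (\<Sum>l\<in>UNIV. \<Sum>m\<in>UNIV. G i j m * (H $ k $ l * h x $ l $ m))"
      unfolding L_def by (simp add: sum_distrib_left mult_ac symx)
    also have "\<dots> = (\<Sum>m\<in>UNIV. G i j m * (\<Sum>l\<in>UNIV. H $ k $ l * h x $ l $ m))"
      by (subst sum.swap) (simp add: sum_distrib_left)
    also have "\<dots> = G i j k" by (simp add: inv1 if_distrib cong: if_cong)
    finally show ?thesis by simp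
  qed
  have eq1: "(\<forall>i j k. G i j k = christoffel h x i j k) \<longleftrightarrow> (\<forall>i j l. L i j l = K i j l)"
  proof
    assume a: "\<forall>i j k. G i j k = christoffel h x i j k"
    show "\<forall>i j l. L i j l = K i j l"
    proof (intro allI)
      fix i j l
      have "L i j l = (\<Sum>k\<in>UNIV. \<Sum>m\<in>UNIV. K i j m * (h x $ l $ k * H $ k $ m))"
        unfolding L_def a[rule_format] chr by (simp add: sum_distrib_left sum_distrib_right mult_ac symx)
      also have "\<dots> = (\<Sum>m\<in>UNIV. K i j m * (\<Sum>k\<in>UNIV. h x $ l $ k * H $ k $ m))"
        by (subst sum.swap) (simp add: sum_distrib_left)
      also have "\<dots> = K i j l" by (simp add: inv2 if_distrib cong: if_cong)
      finally show "L i j l = K i j l" .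
    qed
  next
    assume "\<forall>i j l. L i j l = K i j l"
    then show "\<forall>i j k. G i j k = christoffel h x i j k" using up chr by simp
  qed
  have met: "(\<forall>i j k. pd k (\<lambda>y. h y $ i $ j) x
        = (\<Sum>l\<in>UNIV. G k i l * h x $ l $ j) + (\<Sum>l\<in>UNIV. G k j l * h x $ i $ l))
     \<longleftrightarrow> (\<forall>i j k. d k i j = L k i j + L k j i)"
  proof -
    have "(\<Sum>l\<in>UNIV. G k j l * h x $ i $ l) = L k j i" for i j k
      unfolding L_def by (intro sum.cong refl arg_cong2[where f = "(*)"] symx)
    then show ?thesis unfolding d_def by (simp add: L_def)
  qed
  have tor: "(\<forall>i j k. G i j k = G j i k) \<longleftrightarrow> (\<forall>i j l. L i j l = L j i l)"
  proof
    assume a: "\<forall>i j k. G i j k = G j i k"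
    show "\<forall>i j l. L i j l = L j i l"
      unfolding L_def using a by (intro allI sum.cong refl arg_cong2[where f = "(*)"]) blast
  next
    assume a: "\<forall>i j l. L i j l = L j i l"
    have "G i j k = G j i k" for i j k
      unfolding up[of i j k] up[of j i k] using a by (intro sum.cong refl arg_cong2[where f = "(*)"]) blast
    then show "\<forall>i j k. G i j k = G j i k" by blast
  qed
  have "(\<forall>i j l. L i j l = K i j l) \<longleftrightarrow>
     (\<forall>i j l. L i j l = L j i l) \<and> (\<forall>i j k. d k i j = L k i j + L k j i)"
  proof
    assume a: "\<forall>i j l. L i j l = K i j l"
    have "L i j l = L j i l" for i j l
      unfolding a[rule_format] K_def using dsym[of l i j] by simp
    moreover have "d k i j = L k i j + L k j i" for i j k
      unfolding a[rule_format] K_def using dsym[of k i j] dsym[of i k j] dsym[of j k i]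
      by (simp add: field_simps)
    ultimately show "(\<forall>i j l. L i j l = L j i l) \<and> (\<forall>i j k. d k i j = L k i j + L k j i)"
      by blast
  next
    assume a: "(\<forall>i j l. L i j l = L j i l) \<and> (\<forall>i j k. d k i j = L k i j + L k j i)"
    show "\<forall>i j l. L i j l = K i j l"
    proof (intro allI)
      fix i j l
      have "d i j l = L i j l + L i l j" "d j i l = L j i l + L j l i" "d l i j = L l i j + L l j i"
        "L i j l = L j i l" "L i l j = L l i j" "L j l i = L l j i" using a by blast+
      then show "L i j l = K i j l" unfolding K_def by simp
    qed
  qed
  then show ?thesis using eq1 met tor by simp
qed

lemma second_difference:
  fixes f :: "'v::real_normed_vector \<Rightarrow> real"
  assumes S: "\<And>s t. 0 \<le> s \<Longrightarrow> s \<le> r \<Longrightarrow> 0 \<le> t \<Longrightarrow> t \<le> r \<Longrightarrow> x + s *\<^sub>R u + t *\<^sub>R v \<in> S"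
    and f: "\<And>y. y \<in> S \<Longrightarrow> f differentiable (at y)"
    and fu: "\<And>y. y \<in> S \<Longrightarrow> (\<lambda>z. frechet_derivative f (at z) u) differentiable (at y)"
    and r: "0 < r"
  shows "\<exists>s t. 0 < s \<and> s < r \<and> 0 < t \<and> t < r \<and>
    f (x + r *\<^sub>R u + r *\<^sub>R v) - f (x + r *\<^sub>R u) - f (x + r *\<^sub>R v) + f x
     = r * r * frechet_derivative (\<lambda>z. frechet_derivative f (at z) u) (at (x + s *\<^sub>R u + t *\<^sub>R v)) v"
proof -
  define fu' where "fu' z = frechet_derivative f (at z) u" for z
  have d1: "((\<lambda>s. f (x + s *\<^sub>R u + t *\<^sub>R v)) has_field_derivative fu' (x + s *\<^sub>R u + t *\<^sub>R v)) (at s)"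
    if "0 \<le> s" "s \<le> r" "0 \<le> t" "t \<le> r" for s t
  proof -
    have D: "(f has_derivative frechet_derivative f (at (x + s *\<^sub>R u + t *\<^sub>R v))) (at (x + s *\<^sub>R u + t *\<^sub>R v))"
      using f[OF S[OF that]] frechet_derivative_works by blast
    have "((\<lambda>s. x + s *\<^sub>R u + t *\<^sub>R v) has_derivative (\<lambda>k. k *\<^sub>R u)) (at s)"
      by (auto intro!: derivative_eq_intros)
    from has_derivative_compose[OF this D]
    have "((\<lambda>s. f (x + s *\<^sub>R u + t *\<^sub>R v)) has_derivative
       (\<lambda>k. frechet_derivative f (at (x + s *\<^sub>R u + t *\<^sub>R v)) (k *\<^sub>R u))) (at s)" .
    moreover have "(\<lambda>k. frechet_derivative f (at (x + s *\<^sub>R u + t *\<^sub>R v)) (k *\<^sub>R u))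
      = (*) (fu' (x + s *\<^sub>R u + t *\<^sub>R v))"
      unfolding fu'_def using linear_frechet_derivative[OF f[OF S[OF that]]]
      by (auto simp: linear_cmul mult.commute)
    ultimately show ?thesis unfolding has_field_derivative_def by simp
  qed
  have d2: "((\<lambda>t. fu' (x + s *\<^sub>R u + t *\<^sub>R v)) has_field_derivative
       frechet_derivative fu' (at (x + s *\<^sub>R u + t *\<^sub>R v)) v) (at t)"
    if "0 \<le> s" "s \<le> r" "0 \<le> t" "t \<le> r" for s t
  proof -
    have F: "fu' differentiable (at (x + s *\<^sub>R u + t *\<^sub>R v))"
      using fu[OF S[OF that]] unfolding fu'_def .
    then have D: "(fu' has_derivative frechet_derivative fu' (at (x + s *\<^sub>R u + t *\<^sub>R v))) (at (x + s *\<^sub>R u + t *\<^sub>R v))"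
      using frechet_derivative_works by blast
    have "((\<lambda>t. x + s *\<^sub>R u + t *\<^sub>R v) has_derivative (\<lambda>k. k *\<^sub>R v)) (at t)"
      by (auto intro!: derivative_eq_intros)
    from has_derivative_compose[OF this D]
    have "((\<lambda>t. fu' (x + s *\<^sub>R u + t *\<^sub>R v)) has_derivative
       (\<lambda>k. frechet_derivative fu' (at (x + s *\<^sub>R u + t *\<^sub>R v)) (k *\<^sub>R v))) (at t)" .
    moreover have "(\<lambda>k. frechet_derivative fu' (at (x + s *\<^sub>R u + t *\<^sub>R v)) (k *\<^sub>R v))
      = (*) (frechet_derivative fu' (at (x + s *\<^sub>R u + t *\<^sub>R v)) v)"
      using linear_frechet_derivative[OF F]
      by (auto simp: linear_cmul mult.commute)
    ultimately show ?thesis unfolding has_field_derivative_def by simp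
  qed
  have "\<exists>s. 0 < s \<and> s < r \<and>
     (f (x + r *\<^sub>R u + r *\<^sub>R v) - f (x + r *\<^sub>R u + 0 *\<^sub>R v)) - (f (x + 0 *\<^sub>R u + r *\<^sub>R v) - f (x + 0 *\<^sub>R u + 0 *\<^sub>R v))
      = (r - 0) * (fu' (x + s *\<^sub>R u + r *\<^sub>R v) - fu' (x + s *\<^sub>R u + 0 *\<^sub>R v))"
    using r by (intro MVT2[of 0 r "\<lambda>s. f (x + s *\<^sub>R u + r *\<^sub>R v) - f (x + s *\<^sub>R u + 0 *\<^sub>R v)"
          "\<lambda>s. fu' (x + s *\<^sub>R u + r *\<^sub>R v) - fu' (x + s *\<^sub>R u + 0 *\<^sub>R v)"] DERIV_diff d1) auto
  then obtain s where s: "0 < s" "s < r" and 1: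
     "f (x + r *\<^sub>R u + r *\<^sub>R v) - f (x + r *\<^sub>R u) - f (x + r *\<^sub>R v) + f x
      = r * (fu' (x + s *\<^sub>R u + r *\<^sub>R v) - fu' (x + s *\<^sub>R u + 0 *\<^sub>R v))" by auto
  have "\<exists>t. 0 < t \<and> t < r \<and> fu' (x + s *\<^sub>R u + r *\<^sub>R v) - fu' (x + s *\<^sub>R u + 0 *\<^sub>R v)
     = (r - 0) * frechet_derivative fu' (at (x + s *\<^sub>R u + t *\<^sub>R v)) v"
    using s by (intro MVT2[of 0 r "\<lambda>t. fu' (x + s *\<^sub>R u + t *\<^sub>R v)"] d2) auto
  then obtain t where t: "0 < t" "t < r" "fu' (x + s *\<^sub>R u + r *\<^sub>R v) - fu' (x + s *\<^sub>R u + 0 *\<^sub>R v)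
     = r * frechet_derivative fu' (at (x + s *\<^sub>R u + t *\<^sub>R v)) v" by auto
  show ?thesis
    using s t 1 unfolding fu'_def[abs_def] by (intro exI[of _ s] exI[of _ t]) simp
qed

lemma frechet_derivative_commute:
  fixes f :: "'v::real_normed_vector \<Rightarrow> real"
  assumes "open S" "x \<in> S" and f: "smooth_on S f"
  shows "frechet_derivative (\<lambda>z. frechet_derivative f (at z) u) (at x) v
    = frechet_derivative (\<lambda>z. frechet_derivative f (at z) v) (at x) u"
proof (rule ccontr)
  define p where "p y = frechet_derivative (\<lambda>z. frechet_derivative f (at z) u) (at y) v" for y
  define q where "q y = frechet_derivative (\<lambda>z. frechet_derivative f (at z) v) (at y) u" for y
  assume "\<not> ?thesis"
  then have ne: "p x \<noteq> q x" by (simp add: p_def q_def)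
  define e where "e = \<bar>p x - q x\<bar> / 2"
  have e: "e > 0" using ne by (simp add: e_def)
  have cp: "continuous_on S p" and cq: "continuous_on S q"
    unfolding p_def q_def by (intro smooth_on_continuous smooth_on_frechet f)+
  obtain d0 where d0: "d0 > 0" "ball x d0 \<subseteq> S" using assms(1,2) open_contains_ball by blast
  obtain d1 where d1: "d1 > 0" "\<And>y. y \<in> S \<Longrightarrow> dist y x < d1 \<Longrightarrow> dist (p y) (p x) < e"
    using cp assms(2) e unfolding continuous_on_iff by metis
  obtain d2 where d2: "d2 > 0" "\<And>y. y \<in> S \<Longrightarrow> dist y x < d2 \<Longrightarrow> dist (q y) (q x) < e"
    using cq assms(2) e unfolding continuous_on_iff by metis
  define d where "d = min d0 (min d1 d2)"
  define r where "r = d / (2 * (norm u + norm v + 1))"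
  have d: "d > 0" using d0 d1 d2 by (simp add: d_def)
  have pos: "2 * (norm u + norm v + 1) > 0" by (smt (verit) norm_ge_zero)
  have r: "r > 0" using d pos by (simp add: r_def)
  have rb: "r * (norm u + norm v) < d"
  proof -
    have "r * (norm u + norm v) \<le> r * (norm u + norm v + 1)" using r by simp
    also have "\<dots> = d / 2" using pos by (simp add: r_def field_simps)
    finally show ?thesis using d by simp
  qed
  have near: "dist (x + s *\<^sub>R u + t *\<^sub>R v) x < d"
    if "0 \<le> s" "s \<le> r" "0 \<le> t" "t \<le> r" for s t
  proof -
    have "dist (x + s *\<^sub>R u + t *\<^sub>R v) x = norm (s *\<^sub>R u + t *\<^sub>R v)" by (simp add: dist_norm algebra_simps)
    also have "\<dots> \<le> s * norm u + t * norm v" using norm_triangle_ineq[of "s *\<^sub>R u" "t *\<^sub>R v"] that by simp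
    also have "\<dots> \<le> r * norm u + r * norm v" using that by (intro add_mono mult_right_mono) auto
    also have "\<dots> < d" using rb by (simp add: algebra_simps)
    finally show ?thesis .
  qed
  have inS: "y \<in> S" if "dist y x < d" for y
    using that d0(2) by (auto simp: d_def dist_commute subset_iff)
  have df: "f differentiable (at y)" "(\<lambda>z. frechet_derivative f (at z) w) differentiable (at y)" if "y \<in> S" for y w
    using smooth_on_differentiable that f smooth_on_frechet by blast+
  obtain s t where 1: "0 < s" "s < r" "0 < t" "t < r"
    "f (x + r *\<^sub>R u + r *\<^sub>R v) - f (x + r *\<^sub>R u) - f (x + r *\<^sub>R v) + f x = r * r * p (x + s *\<^sub>R u + t *\<^sub>R v)"
    using second_difference[of r x u v S f] inS near df r unfolding p_def by blast
  have near': "dist (x + s *\<^sub>R v + t *\<^sub>R u) x < d"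
    if "0 \<le> s" "s \<le> r" "0 \<le> t" "t \<le> r" for s t
    using near[of t s] that by (simp add: add_ac)
  obtain s' t' where 2: "0 < s'" "s' < r" "0 < t'" "t' < r"
    "f (x + r *\<^sub>R v + r *\<^sub>R u) - f (x + r *\<^sub>R v) - f (x + r *\<^sub>R u) + f x = r * r * q (x + s' *\<^sub>R v + t' *\<^sub>R u)"
    using second_difference[of r x v u S f] inS near' df r unfolding q_def by blast
  have eq: "x + r *\<^sub>R v + r *\<^sub>R u = x + r *\<^sub>R u + r *\<^sub>R v" by (simp add: add_ac)
  have "r * r * p (x + s *\<^sub>R u + t *\<^sub>R v) = r * r * q (x + s' *\<^sub>R v + t' *\<^sub>R u)"
    using 1(5) 2(5) unfolding eq by linarith
  then have pq: "p (x + s *\<^sub>R u + t *\<^sub>R v) = q (x + s' *\<^sub>R v + t' *\<^sub>R u)" using r by simp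
  have "dist (p (x + s *\<^sub>R u + t *\<^sub>R v)) (p x) < e"
    using d1(2) inS near[of s t] 1 by (simp add: d_def)
  moreover have "dist (q (x + s' *\<^sub>R v + t' *\<^sub>R u)) (q x) < e"
    using d2(2) inS near'[of s' t'] 2 by (simp add: d_def)
  ultimately show False using pq unfolding e_def dist_real_def by argo
qed

lemma pd_commute:
  fixes f :: "real^'n::finite \<Rightarrow> real"
  assumes "open S" "x \<in> S" "smooth_on S f"
  shows "pd i (pd j f) x = pd j (pd i f) x"
  using frechet_derivative_commute[OF assms] unfolding pd_def[abs_def] by simp

lemma differentiable_prod_real:
  fixes f :: "'i \<Rightarrow> 'v::real_normed_vector \<Rightarrow> real"
  assumes "finite I" "\<And>i. i \<in> I \<Longrightarrow> f i differentiable (at x)"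
  shows "(\<lambda>y. \<Prod>i\<in>I. f i y) differentiable (at x)"
  using assms by (induction I rule: finite_induct) (auto intro!: derivative_intros differentiable_mult)

lemma differentiable_det:
  fixes M :: "'v::real_normed_vector \<Rightarrow> real^'n::finite^'n"
  assumes "\<And>i j. (\<lambda>y. M y $ i $ j) differentiable (at x)"
  shows "(\<lambda>y. det (M y)) differentiable (at x)"
  unfolding det_def
  by (intro differentiable_sum differentiable_mult differentiable_prod_real assms)
     (auto simp: finite_permutations intro!: differentiable_prod_real assms)

lemma differentiable_matrix_inv:
  fixes M :: "'v::real_normed_vector \<Rightarrow> real^'n::finite^'n"
  assumes "open S" "x \<in> S" "\<And>y. y \<in> S \<Longrightarrow> invertible (M y)" "M differentiable (at x)"
  shows "(\<lambda>y. matrix_inv (M y) $ k $ l) differentiable (at x)"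
proof -
  have d: "(\<lambda>y. M y $ i $ j) differentiable (at x)" for i j
    by (intro differentiable_nth assms)
  define N where "N y = (\<chi> i j. if j = k then axis l 1 $ i else M y $ i $ j)" for y
  have eq: "det (N y) / det (M y) = matrix_inv (M y) $ k $ l" if "y \<in> S" for y
  proof -
    have "M y *v (matrix_inv (M y) *v axis l 1) = axis l 1"
      using matrix_inv_both(1)[OF assms(3)[OF that]] by (simp add: matrix_vector_mul_assoc)
    then have "matrix_inv (M y) *v axis l 1 = (\<chi> k. det(\<chi> i j. if j=k then axis l 1 $ i else M y $ i $ j) / det (M y))"
      using cramer[of "M y"] assms(3)[OF that] invertible_det_nz by blast
    from arg_cong[OF this, of "\<lambda>v. v $ k"]
    have "(matrix_inv (M y) *v axis l 1) $ k = det (N y) / det (M y)" by (simp add: N_def)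
    moreover have "(matrix_inv (M y) *v axis l 1) $ k = matrix_inv (M y) $ k $ l"
      by (simp add: matrix_vector_mult_basis column_def)
    ultimately show ?thesis by simp
  qed
  have "(\<lambda>y. det (N y)) differentiable (at x)"
  proof (rule differentiable_det)
    fix i j show "(\<lambda>y. N y $ i $ j) differentiable (at x)"
      using d by (cases "j = k") (auto simp: N_def)
  qed
  moreover have "det (M x) \<noteq> 0" using assms(2,3) invertible_det_nz by blast
  ultimately have "(\<lambda>y. det (N y) / det (M y)) differentiable (at x)"
    using differentiable_det[of M x] d by (intro differentiable_divide) auto
  from differentiable_cong_open[OF assms(1,2) eq this] show ?thesis .
qed

lemma christoffel_differentiable:
  fixes h :: "real^'n::finite \<Rightarrow> real^'n^'n"
  assumes "open S" "x \<in> S" "smooth_on S h" "\<And>y. y \<in> S \<Longrightarrow> invertible (h y)"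
  shows "(\<lambda>y. christoffel h y i j k) differentiable (at x)"
proof -
  have dh: "h differentiable (at y)" if "y \<in> S" for y using that assms(3) smooth_on_differentiable by blast
  have p: "(\<lambda>y. pd a (\<lambda>y. h y $ b $ c) y) differentiable (at x)" for a b c
  proof (rule differentiable_cong_open[OF assms(1,2)])
    show "(\<lambda>y. frechet_derivative h (at y) (axis a 1) $ b $ c) differentiable (at x)"
      by (intro differentiable_nth smooth_on_differentiable[OF smooth_on_frechet[OF assms(3)] assms(2)])
  next
    fix y assume "y \<in> S"
    show "frechet_derivative h (at y) (axis a 1) $ b $ c = pd a (\<lambda>y. h y $ b $ c) y"
      unfolding pd_def using frechet_nth2[OF dh[OF \<open>y \<in> S\<close>]] by simp
  qed
  show ?thesis unfolding christoffel_def
    by (intro differentiable_mult differentiable_sum differentiable_add differentiable_diff p ballI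
        differentiable_const differentiable_matrix_inv[OF assms(1,2,4) dh[OF assms(2)]] finite)
qed

lemma pd_diff: "f differentiable (at x) \<Longrightarrow> g differentiable (at x) \<Longrightarrow>
   pd i (\<lambda>y. f y - g y) x = pd i f x - pd i g x"
  unfolding pd_def using frechet_derivative_at[OF has_derivative_diff] frechet_derivative_works by metis

lemma pd_sum: "finite I \<Longrightarrow> (\<And>p. p \<in> I \<Longrightarrow> f p differentiable (at x)) \<Longrightarrow>
   pd i (\<lambda>y. \<Sum>p\<in>I. f p y) x = (\<Sum>p\<in>I. pd i (f p) x)"
proof -
  assume a: "finite I" "\<And>p. p \<in> I \<Longrightarrow> f p differentiable (at x)"
  have "((\<lambda>y. \<Sum>p\<in>I. f p y) has_derivative (\<lambda>v. \<Sum>p\<in>I. frechet_derivative (f p) (at x) v)) (at x)"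
    using a frechet_derivative_works by (intro has_derivative_sum) blast
  from frechet_derivative_at[OF this, symmetric] show ?thesis unfolding pd_def by simp
qed

lemma pd_mult: fixes f g :: "real^'n::finite \<Rightarrow> real"
  assumes "f differentiable (at x)" "g differentiable (at x)"
  shows "pd i (\<lambda>y. f y * g y) x = f x * pd i g x + pd i f x * g x"
proof -
  have "((\<lambda>y. f y * g y) has_derivative
     (\<lambda>v. f x * frechet_derivative g (at x) v + frechet_derivative f (at x) v * g x)) (at x)"
    using assms frechet_derivative_works by (intro has_derivative_mult) blast+
  from frechet_derivative_at[OF this, symmetric] show ?thesis unfolding pd_def by simp
qed

lemma cov11_antisym:
  fixes h :: "real^'n::finite \<Rightarrow> real^'n^'n" and \<alpha> :: "real^'n \<Rightarrow> real^'n"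
  assumes S: "open S" "x \<in> S" and h: "smooth_on S h"
    and sym: "\<And>y. y \<in> S \<Longrightarrow> transpose (h y) = h y" and inv: "\<And>y. y \<in> S \<Longrightarrow> invertible (h y)"
    and \<alpha>: "\<And>k. smooth_on S (\<lambda>y. \<alpha> y $ k)"
  shows "cov11 h \<alpha> x i j k - cov11 h \<alpha> x j i k = - (\<Sum>p\<in>UNIV.
     (pd i (\<lambda>y. christoffel h y j k p) x - pd j (\<lambda>y. christoffel h y i k p) x
      + (\<Sum>q\<in>UNIV. christoffel h x j k q * christoffel h x i q p
           - christoffel h x i k q * christoffel h x j q p)) * \<alpha> x $ p)"
proof -
  let ?G = "christoffel h"
  have Gs: "?G x i j k = ?G x j i k" for i j k
    using christoffel_iff_levi_civita[where h = h and G = "christoffel h x", OF S sym inv[OF S(2)]] by blast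
  have dG: "(\<lambda>y. ?G y i j k) differentiable (at x)" for i j k
    by (rule christoffel_differentiable[OF S h inv])
  have d\<alpha>: "(\<lambda>y. \<alpha> y $ k) differentiable (at x)" for k
    by (rule smooth_on_differentiable[OF \<alpha> S(2)])
  have dd\<alpha>: "pd j (\<lambda>y. \<alpha> y $ k) differentiable (at x)" for j k
    unfolding pd_def[abs_def] by (rule smooth_on_differentiable[OF smooth_on_frechet[OF \<alpha>] S(2)])
  have e1: "pd i (\<lambda>y. cov1 h \<alpha> y j k) x = pd i (pd j (\<lambda>y. \<alpha> y $ k)) x
     - (\<Sum>p\<in>UNIV. ?G x j k p * pd i (\<lambda>y. \<alpha> y $ p) x) - (\<Sum>p\<in>UNIV. pd i (\<lambda>y. ?G y j k p) x * \<alpha> x $ p)"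
    for i j k
  proof -
    have "pd i (\<lambda>y. cov1 h \<alpha> y j k) x = pd i (pd j (\<lambda>y. \<alpha> y $ k)) x
       - pd i (\<lambda>y. \<Sum>p\<in>UNIV. ?G y j k p * \<alpha> y $ p) x"
      unfolding cov1_def
      by (intro pd_diff dd\<alpha> differentiable_sum differentiable_mult dG d\<alpha> ballI finite)
    also have "pd i (\<lambda>y. \<Sum>p\<in>UNIV. ?G y j k p * \<alpha> y $ p) x
        = (\<Sum>p\<in>UNIV. ?G x j k p * pd i (\<lambda>y. \<alpha> y $ p) x + pd i (\<lambda>y. ?G y j k p) x * \<alpha> x $ p)"
      by (subst pd_sum) (auto intro!: differentiable_mult dG d\<alpha> sum.cong simp: pd_mult[OF dG d\<alpha>])
    finally show ?thesis by (simp add: sum.distrib)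
  qed
  have e2: "(\<Sum>q\<in>UNIV. ?G x i k q * cov1 h \<alpha> x j q) = (\<Sum>q\<in>UNIV. ?G x i k q * pd j (\<lambda>y. \<alpha> y $ q) x)
     - (\<Sum>p\<in>UNIV. (\<Sum>q\<in>UNIV. ?G x i k q * ?G x j q p) * \<alpha> x $ p)" for i j k
  proof -
    have "(\<Sum>q\<in>UNIV. ?G x i k q * cov1 h \<alpha> x j q) = (\<Sum>q\<in>UNIV. ?G x i k q * pd j (\<lambda>y. \<alpha> y $ q) x)
      - (\<Sum>q\<in>UNIV. \<Sum>p\<in>UNIV. ?G x i k q * ?G x j q p * \<alpha> x $ p)"
      unfolding cov1_def by (simp add: right_diff_distrib sum_subtractf sum_distrib_left mult.assoc)
    also have "(\<Sum>q\<in>UNIV. \<Sum>p\<in>UNIV. ?G x i k q * ?G x j q p * \<alpha> x $ p)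
       = (\<Sum>p\<in>UNIV. (\<Sum>q\<in>UNIV. ?G x i k q * ?G x j q p) * \<alpha> x $ p)"
      by (subst sum.swap) (simp add: sum_distrib_right)
    finally show ?thesis .
  qed
  have e3: "(\<Sum>p\<in>UNIV. ?G x i j p * cov1 h \<alpha> x p k) = (\<Sum>p\<in>UNIV. ?G x j i p * cov1 h \<alpha> x p k)"
    using Gs[of i j] by simp
  have c: "pd i (pd j (\<lambda>y. \<alpha> y $ k)) x = pd j (pd i (\<lambda>y. \<alpha> y $ k)) x"
    by (rule pd_commute[OF S \<alpha>])
  show ?thesis
    unfolding cov11_def cov2_def vec_lambda_beta
    using e3 c by (simp add: e1 e2 sum.distrib sum_subtractf algebra_simps)
qed

lemma smooth_on_const [simp]: "smooth_on S (\<lambda>x. c)"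
proof -
  have "Ck_on k S (\<lambda>x::'a. c::'b)" for k c
    by (induction k arbitrary: c) auto
  then show ?thesis by (simp add: smooth_on_def)
qed

lemma curv_christoffel:
  fixes h :: "real^'n::finite \<Rightarrow> real^'n^'n"
  assumes S: "open S" "x \<in> S" and h: "smooth_on S h"
    and sym: "\<And>y. y \<in> S \<Longrightarrow> transpose (h y) = h y" and inv: "\<And>y. y \<in> S \<Longrightarrow> invertible (h y)"
  shows "curv h x i j k p = pd i (\<lambda>y. christoffel h y j k p) x - pd j (\<lambda>y. christoffel h y i k p) x
      + (\<Sum>q\<in>UNIV. christoffel h x j k q * christoffel h x i q p
           - christoffel h x i k q * christoffel h x j q p)"
  unfolding curv_def
  by (subst cov11_antisym[OF assms]) (simp_all add: axis_def if_distrib cong: if_cong)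

lemma ricci_identity:
  fixes h :: "real^'n::finite \<Rightarrow> real^'n^'n" and \<alpha> :: "real^'n \<Rightarrow> real^'n"
  assumes S: "open S" "x \<in> S" and h: "smooth_on S h"
    and sym: "\<And>y. y \<in> S \<Longrightarrow> transpose (h y) = h y" and inv: "\<And>y. y \<in> S \<Longrightarrow> invertible (h y)"
    and \<alpha>: "\<And>k. smooth_on S (\<lambda>y. \<alpha> y $ k)"
  shows "cov11 h \<alpha> x i j k - cov11 h \<alpha> x j i k = - (\<Sum>p\<in>UNIV. curv h x i j k p * \<alpha> x $ p)"
  by (simp only: cov11_antisym[OF assms] curv_christoffel[OF S h sym inv])

lemma rep_dom_param:
  assumes "smooth_manifold X A" "c \<in> A"
  shows "inj_on (coord c) (chart_dom c)"
    "p \<in> chart_dom c \<Longrightarrow> param c (coord c p) = p"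
    "x \<in> rep_dom c d f \<longleftrightarrow> x \<in> chart_img c \<and> f (param c x) \<in> chart_dom d"
    "x \<in> chart_img c \<Longrightarrow> param c x \<in> chart_dom c \<and> coord c (param c x) = x"
proof -
  have hm: "homeomorphic_map (subtopology X (chart_dom c)) (top_of_set (chart_img c)) (coord c)"
    and o: "openin X (chart_dom c)"
    using assms unfolding smooth_manifold_def by auto
  have ts: "topspace (subtopology X (chart_dom c)) = chart_dom c"
    using openin_subset[OF o] by auto
  show inj: "inj_on (coord c) (chart_dom c)"
    using homeomorphic_imp_injective_map[OF hm] ts by simp
  show par: "p \<in> chart_dom c \<Longrightarrow> param c (coord c p) = p" for p
    unfolding param_def using inj by simp
  show "x \<in> chart_img c \<Longrightarrow> param c x \<in> chart_dom c \<and> coord c (param c x) = x"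
    unfolding chart_img_def using par by auto
  show "x \<in> rep_dom c d f \<longleftrightarrow> x \<in> chart_img c \<and> f (param c x) \<in> chart_dom d"
    unfolding chart_img_def rep_dom_def using par by force
qed

lemma open_rep_dom:
  assumes "smooth_manifold X A" "smooth_manifold Y B" "continuous_map X Y f" "c \<in> A" "d \<in> B"
  shows "open (rep_dom c d f)"
proof -
  have hm: "homeomorphic_map (subtopology X (chart_dom c)) (top_of_set (chart_img c)) (coord c)"
    and o: "openin X (chart_dom c)" and oi: "open (chart_img c)"
    using assms unfolding smooth_manifold_def by auto
  have od: "openin Y (chart_dom d)" using assms unfolding smooth_manifold_def by auto
  have "openin X {x \<in> topspace X. f x \<in> chart_dom d}"
    using openin_continuous_map_preimage[OF assms(3) od] .
  then have "openin X (chart_dom c \<inter> {x \<in> topspace X. f x \<in> chart_dom d})"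
    using o by blast
  moreover have "chart_dom c \<inter> {x \<in> topspace X. f x \<in> chart_dom d} = chart_dom c \<inter> f -` chart_dom d"
    using openin_subset[OF o] by auto
  ultimately have "openin (subtopology X (chart_dom c)) (chart_dom c \<inter> f -` chart_dom d)"
    by (metis Int_lower1 inf.absorb1 openin_subtopology)
  then have "openin (top_of_set (chart_img c)) (rep_dom c d f)"
    unfolding rep_dom_def using homeomorphic_imp_open_map[OF hm] unfolding open_map_def by blast
  then show ?thesis using oi openin_open_trans by blast
qed

lemma pullback_eq:
  assumes M: "smooth_manifold X A" and N: "smooth_manifold Y B" and f: "smooth_map X A Y B f"
    and g: "sym_tensor2 B g" and c: "c \<in> A" and d: "d \<in> B" and x: "x \<in> rep_dom c d f"
  shows "pullback B f g c x = transpose (jacobian (local_rep c d f) (at x))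
     ** g d (local_rep c d f x) ** jacobian (local_rep c d f) (at x)"
proof -
  define e where "e = (SOME d. d \<in> B \<and> f (param c x) \<in> chart_dom d)"
  have fx: "x \<in> chart_img c" "f (param c x) \<in> chart_dom d"
    using x rep_dom_param(3)[OF M c, of x d f] by blast+
  have e: "e \<in> B" "f (param c x) \<in> chart_dom e"
    using someI[of "\<lambda>d. d \<in> B \<and> f (param c x) \<in> chart_dom d" d] d fx unfolding e_def by auto
  then have xe: "x \<in> rep_dom c e f" using fx rep_dom_param(3)[OF M c, of x e f] by blast
  let ?F = "local_rep c d f" and ?E = "local_rep c e f" and ?T = "local_rep e d id"
  have cf: "continuous_map X Y f" using f by (simp add: smooth_map_def)
  have dE: "?E differentiable (at x)"
  proof -
    have "smooth_on (rep_dom c e f) ?E" using f c e(1) unfolding smooth_map_def by simp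
    then show ?thesis using xe smooth_on_differentiable by metis
  qed
  have Ex: "?E x \<in> rep_dom e d id"
    using e(2) fx(2) by (auto simp: local_rep_def rep_dom_def)
  have dT: "?T differentiable (at (?E x))"
  proof -
    have "\<forall>c\<in>B. \<forall>c'\<in>B. smooth_on (rep_dom c c' id) (local_rep c c' id)"
      using N unfolding smooth_manifold_def by (elim conjE)
    from bspec[OF bspec[OF this e(1)] d] have "smooth_on (rep_dom e d id) ?T" .
    then show ?thesis using Ex smooth_on_differentiable by metis
  qed
  have TE: "?T (?E y) = ?F y" if "y \<in> rep_dom c e f" for y
    using that rep_dom_param(3)[OF M c, of y e f] rep_dom_param(2)[OF N e(1)] by (simp add: local_rep_def)
  have "((\<lambda>y. ?T (?E y)) has_derivative (\<lambda>v. jacobian ?T (at (?E x)) *v (jacobian ?E (at x) *v v))) (at x)"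
    by (rule has_derivative_compose[OF dE[unfolded jacobian_works] dT[unfolded jacobian_works]])
  then have "(?F has_derivative (\<lambda>v. (jacobian ?T (at (?E x)) ** jacobian ?E (at x)) *v v)) (at x)"
    unfolding matrix_vector_mul_assoc
    by (rule has_derivative_transform_within_open[OF _ open_rep_dom[OF M N cf c e(1)] xe TE])
  then have J: "jacobian ?F (at x) = jacobian ?T (at (?E x)) ** jacobian ?E (at x)"
    by (simp add: jacobian_def[of ?F] frechet_derivative_at[symmetric])
  have "g e (?E x) = transpose (jacobian ?T (at (?E x))) ** g d (?T (?E x)) ** jacobian ?T (at (?E x))"
  proof -
    have "\<forall>c\<in>B. \<forall>c'\<in>B. \<forall>x\<in>rep_dom c c' id.
        g c x = transpose (jacobian (local_rep c c' id) (at x)) ** g c' (local_rep c c' id x)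
                  ** jacobian (local_rep c c' id) (at x)"
      using g unfolding sym_tensor2_def by (elim conjE)
    from bspec[OF bspec[OF bspec[OF this e(1)] d] Ex] show ?thesis .
  qed
  then show ?thesis
    unfolding pullback_def Let_def e_def[symmetric]
    by (simp add: J TE[OF xe] matrix_transpose_mul matrix_mul_assoc)
qed

end

theory Submission
  imports Defs
begin

text \<open>The coupled projectively flat equations for \<open>(h, \<Pi>)\<close> are the Gauss and Codazzi equations of the
  hypersurface, specialised to an ambient space of constant curvature. The Gauss equation reads
  \<open>\<langle>R\<^sup>g(\<partial>\<^sub>iF, \<partial>\<^sub>jF) \<partial>\<^sub>kF, \<partial>\<^sub>lF\<rangle> = Riem\<^sub>i\<^sub>j\<^sub>k\<^sub>l + \<epsilon> (\<Pi> \<circledast> \<Pi>)\<^sub>i\<^sub>j\<^sub>k\<^sub>l\<close>, and constant curvature makes the left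
  side a multiple of \<open>h \<circledast> h\<close>, since \<open>g\<close> restricts to \<open>h\<close> on tangent vectors. The Codazzi equation
  reads \<open>\<langle>R\<^sup>g(\<partial>\<^sub>iF, \<partial>\<^sub>jF) \<partial>\<^sub>kF, Z\<rangle> = \<epsilon> (D\<^sub>i\<Pi>\<^sub>j\<^sub>k - D\<^sub>j\<Pi>\<^sub>i\<^sub>k)\<close>, and constant curvature makes the left side
  vanish, since \<open>Z\<close> is orthogonal to the tangent vectors. Vanishing mean curvature is the trace
  condition, and a double contraction of the Gauss equation (\<open>scal_minimal_Gauss\<close>) then gives the
  formula for the scalar curvature.

  Both equations are instances of one identity (\<open>Riem_form_along\<close>) for vector fields \<open>V, V'\<close> along a
  map \<open>F\<close> into a space with metric \<open>g\<close>:
  \<open>\<langle>R(\<partial>\<^sub>iF, \<partial>\<^sub>jF) V, V'\<rangle> = (\<partial>\<^sub>i\<langle>\<nabla>\<^sub>jV, V'\<rangle> - \<langle>\<nabla>\<^sub>jV, \<nabla>\<^sub>iV'\<rangle>) - (\<partial>\<^sub>j\<langle>\<nabla>\<^sub>iV, V'\<rangle> - \<langle>\<nabla>\<^sub>iV, \<nabla>\<^sub>jV'\<rangle>)\<close>.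
  It follows from the commutator of covariant derivatives (\<open>nabla_commutator\<close>) and the Leibniz rule
  (\<open>pd_metric_inner\<close>). Applied to the immersion it gives the ambient curvature, and applied to the
  identity map with the metric \<open>h\<close> it gives the intrinsic one. The two are compared by means of the
  Gauss formula \<open>\<nabla>\<^sub>i \<partial>\<^sub>jF = \<Gamma>\<^sub>i\<^sub>j\<^sup>k \<partial>\<^sub>kF + \<Pi>\<^sub>i\<^sub>j Z\<close> (\<open>Gauss_formula\<close>), which holds because the tangential
  part of the ambient connection is torsion-free and compatible with \<open>h\<close>.

  Being a smooth tensor field on the hypersurface is part of what has to be shown for \<open>h\<close>; this
  is \<open>pullback_sym_tensor2\<close>, which rests on closure of the smooth maps under composition and
  bilinear products.\<close>

section \<open>Calculus of smooth maps\<close>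

lemma Ck_on_Suc_imp: "Ck_on (Suc k) S f \<Longrightarrow> Ck_on k S f"
proof (induction k arbitrary: f)
  case 0
  then show ?case
    by (auto intro!: differentiable_imp_continuous_on differentiable_at_imp_differentiable_on)
next
  case (Suc k)
  then show ?case by (metis Ck_on.simps(2))
qed

text \<open>Being of class \<open>C\<^sup>k\<close> is a local property, because maps that agree on an open set have the
  same derivatives there. This is what allows the pullback metric to be examined in one target
  chart at a time.\<close>

lemma Ck_on_local:
  assumes "open S" "\<And>x. x \<in> S \<Longrightarrow> \<exists>T g. open T \<and> x \<in> T \<and> T \<subseteq> S \<and> Ck_on k T g \<and> (\<forall>y\<in>T. f y = g y)"
  shows "Ck_on k S f"
  using assms(2)
proof (induction k arbitrary: f)
  case 0
  show ?case unfolding Ck_on.simps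
  proof (rule continuous_at_imp_continuous_on, intro ballI)
    fix x assume "x \<in> S"
    then obtain T g where T: "open T" "x \<in> T" "continuous_on T g" "\<forall>y\<in>T. f y = g y"
      using 0 by (metis Ck_on.simps(1))
    then have "continuous_on T f" by (metis continuous_on_cong)
    then show "isCont f x" using continuous_on_eq_continuous_at[OF T(1)] T(2) by blast
  qed
next
  case (Suc k)
  show ?case unfolding Ck_on.simps
  proof (intro conjI ballI allI)
    fix x assume "x \<in> S"
    then obtain T g where T: "open T" "x \<in> T" "Ck_on (Suc k) T g" "\<forall>y\<in>T. f y = g y"
      using Suc.prems by metis
    show "f differentiable at x"
      by (rule differentiable_cong_open[OF T(1,2), of g]) (use T in auto)
  next
    fix v
    show "Ck_on k S (\<lambda>x. frechet_derivative f (at x) v)"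
    proof (rule Suc.IH)
      fix x assume "x \<in> S"
      then obtain T g where T: "open T" "x \<in> T" "T \<subseteq> S" "Ck_on (Suc k) T g" "\<forall>y\<in>T. f y = g y"
        using Suc.prems by metis
      have "\<forall>y\<in>T. frechet_derivative f (at y) v = frechet_derivative g (at y) v"
        using frechet_cong_open[OF T(1), of _ f g] T(5) by metis
      moreover have "Ck_on k T (\<lambda>y. frechet_derivative g (at y) v)" using T(4) by simp
      ultimately show "\<exists>T g. open T \<and> x \<in> T \<and> T \<subseteq> S \<and> Ck_on k T g \<and>
          (\<forall>y\<in>T. frechet_derivative f (at y) v = g y)"
        using T(1-3) by (intro exI[of _ T] exI[of _ "\<lambda>y. frechet_derivative g (at y) v"]) simp
    qed
  qed
qed

lemma Ck_on_cong: "open S \<Longrightarrow> (\<And>x. x \<in> S \<Longrightarrow> f x = g x) \<Longrightarrow> Ck_on k S g \<Longrightarrow> Ck_on k S f"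
  by (rule Ck_on_local) blast+

lemma Ck_on_SucI:
  assumes "open S" "\<And>x. x \<in> S \<Longrightarrow> (f has_derivative f' x) (at x)" "\<And>v. Ck_on k S (\<lambda>x. f' x v)"
  shows "Ck_on (Suc k) S f"
proof -
  have "Ck_on k S (\<lambda>x. frechet_derivative f (at x) v)" for v
    by (rule Ck_on_cong[OF assms(1) _ assms(3)[of v]]) (simp add: frechet_derivative_at[OF assms(2), symmetric])
  then show ?thesis using assms(2) by (auto simp: differentiable_def)
qed

lemma Ck_on_Suc_has_derivative:
  "Ck_on (Suc k) S f \<Longrightarrow> x \<in> S \<Longrightarrow> (f has_derivative frechet_derivative f (at x)) (at x)"
  using frechet_derivative_works by auto

lemma Ck_on_subset: "Ck_on k S f \<Longrightarrow> T \<subseteq> S \<Longrightarrow> Ck_on k T f"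
  by (induction k arbitrary: f) (auto intro: continuous_on_subset)

lemma smooth_on_subset: "smooth_on S f \<Longrightarrow> T \<subseteq> S \<Longrightarrow> smooth_on T f"
  unfolding smooth_on_def using Ck_on_subset by blast

lemma Ck_on_bounded_linear:
  assumes "bounded_linear L" "open S" "Ck_on k S f"
  shows "Ck_on k S (\<lambda>x. L (f x))"
  using assms(3)
proof (induction k arbitrary: f)
  case 0
  then show ?case using bounded_linear.continuous_on[OF assms(1)] by simp
next
  case (Suc k)
  show ?case
  proof (rule Ck_on_SucI[OF assms(2)])
    show "((\<lambda>x. L (f x)) has_derivative (\<lambda>v. L (frechet_derivative f (at x) v))) (at x)" if "x \<in> S" for x
      by (rule bounded_linear.has_derivative[OF assms(1) Ck_on_Suc_has_derivative[OF Suc.prems that]])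
    show "Ck_on k S (\<lambda>x. L (frechet_derivative f (at x) v))" for v
      by (rule Suc.IH) (use Suc.prems in simp)
  qed
qed

lemma Ck_on_add:
  assumes "open S" "Ck_on k S f" "Ck_on k S g"
  shows "Ck_on k S (\<lambda>x. f x + g x)"
  using assms(2,3)
proof (induction k arbitrary: f g)
  case 0
  then show ?case by (auto intro: continuous_on_add)
next
  case (Suc k)
  show ?case
  proof (rule Ck_on_SucI[OF assms(1)])
    show "((\<lambda>x. f x + g x) has_derivative
      (\<lambda>v. frechet_derivative f (at x) v + frechet_derivative g (at x) v)) (at x)" if "x \<in> S" for x
      by (rule has_derivative_add) (rule Ck_on_Suc_has_derivative[OF _ that], rule Suc.prems)+
    show "Ck_on k S (\<lambda>x. frechet_derivative f (at x) v + frechet_derivative g (at x) v)" for v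
      by (rule Suc.IH) (use Suc.prems in simp_all)
  qed
qed

lemma Ck_on_const: "Ck_on k S (\<lambda>x. c)"
  using smooth_on_const unfolding smooth_on_def by blast

lemma Ck_on_sum:
  assumes "open S" "finite I" "\<And>i. i \<in> I \<Longrightarrow> Ck_on k S (f i)"
  shows "Ck_on k S (\<lambda>x. \<Sum>i\<in>I. f i x)"
  using assms(2,3) by (induction I rule: finite_induct) (simp_all add: Ck_on_const Ck_on_add[OF assms(1)])

lemma Ck_on_bilinear:
  assumes "bounded_bilinear b" "open S" "Ck_on k S f" "Ck_on k S g"
  shows "Ck_on k S (\<lambda>x. b (f x) (g x))"
  using assms(3,4)
proof (induction k arbitrary: f g)
  case 0
  then show ?case using bounded_bilinear.continuous_on[OF assms(1)] by simp
next
  case (Suc k)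
  show ?case
  proof (rule Ck_on_SucI[OF assms(2)])
    show "((\<lambda>x. b (f x) (g x)) has_derivative
      (\<lambda>v. b (f x) (frechet_derivative g (at x) v) + b (frechet_derivative f (at x) v) (g x))) (at x)"
      if "x \<in> S" for x
      by (rule bounded_bilinear.FDERIV[OF assms(1)]) (rule Ck_on_Suc_has_derivative[OF _ that], rule Suc.prems)+
    have d: "Ck_on k S (\<lambda>x. frechet_derivative f (at x) v)" "Ck_on k S (\<lambda>x. frechet_derivative g (at x) v)" for v
      using Suc.prems by simp_all
    show "Ck_on k S (\<lambda>x. b (f x) (frechet_derivative g (at x) v) + b (frechet_derivative f (at x) v) (g x))" for v
      by (intro Ck_on_add assms(2) Suc.IH Ck_on_Suc_imp[OF Suc.prems(1)] Ck_on_Suc_imp[OF Suc.prems(2)] d)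
  qed
qed

text \<open>By the chain rule the derivative of the composite is a sum of products
  \<open>(\<partial>\<^sub>a g \<circ> f) \<cdot> \<partial>\<^sub>v f\<^sub>a\<close>, to which the induction hypothesis applies; the finite-dimensional
  domain of \<open>g\<close> provides the basis.\<close>

lemma Ck_on_compose:
  fixes f :: "'v::real_normed_vector \<Rightarrow> 'u::euclidean_space" and g :: "'u \<Rightarrow> 'w::real_normed_vector"
  assumes "open S" "f ` S \<subseteq> T" "smooth_on S f" "Ck_on k T g"
  shows "Ck_on k S (\<lambda>x. g (f x))"
  using assms(4)
proof (induction k arbitrary: g)
  case 0
  then have "continuous_on T g" by simp
  from continuous_on_compose2[OF this smooth_on_continuous[OF assms(3)] assms(2)]
  show ?case by simp
next
  case (Suc k)
  show ?case
  proof (rule Ck_on_SucI[OF assms(1)])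
    fix x assume x: "x \<in> S"
    have df: "(f has_derivative frechet_derivative f (at x)) (at x)"
      using smooth_on_differentiable[OF assms(3) x] frechet_derivative_works by blast
    have "f x \<in> T" using assms(2) x by blast
    note dg = Ck_on_Suc_has_derivative[OF Suc.prems this]
    have lin: "linear (frechet_derivative g (at (f x)))"
      using has_derivative_linear[OF dg] .
    have e: "frechet_derivative g (at (f x)) (\<Sum>b\<in>Basis. (w \<bullet> b) *\<^sub>R b)
        = (\<Sum>b\<in>Basis. (w \<bullet> b) *\<^sub>R frechet_derivative g (at (f x)) b)" for w
      by (simp only: linear_sum[OF lin] linear_cmul[OF lin] o_def)
    have "(\<lambda>v. frechet_derivative g (at (f x)) (frechet_derivative f (at x) v))
        = (\<lambda>v. \<Sum>b\<in>Basis. (frechet_derivative f (at x) v \<bullet> b) *\<^sub>R frechet_derivative g (at (f x)) b)"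
    proof
      fix v
      from e[of "frechet_derivative f (at x) v"]
      show "frechet_derivative g (at (f x)) (frechet_derivative f (at x) v)
        = (\<Sum>b\<in>Basis. (frechet_derivative f (at x) v \<bullet> b) *\<^sub>R frechet_derivative g (at (f x)) b)"
        unfolding euclidean_representation .
    qed
    from has_derivative_compose[OF df dg, unfolded this]
    show "((\<lambda>x. g (f x)) has_derivative (\<lambda>v. \<Sum>b\<in>Basis.
        (frechet_derivative f (at x) v \<bullet> b) *\<^sub>R frechet_derivative g (at (f x)) b)) (at x)" .
  next
    fix v
    have "Ck_on k S (\<lambda>x. frechet_derivative f (at x) v)"
      using smooth_on_frechet[OF assms(3)] by (simp add: smooth_on_def)
    moreover have "Ck_on k S (\<lambda>x. frechet_derivative g (at (f x)) b)" for b
      by (rule Suc.IH) (use Suc.prems in simp)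
    ultimately show "Ck_on k S (\<lambda>x. \<Sum>b\<in>Basis.
        (frechet_derivative f (at x) v \<bullet> b) *\<^sub>R frechet_derivative g (at (f x)) b)"
      by (intro Ck_on_sum Ck_on_bilinear[OF bounded_bilinear_scaleR]
          Ck_on_bounded_linear[OF bounded_linear_inner_left] assms(1) finite_Basis)
  qed
qed

lemma smooth_on_id [simp]: "smooth_on S (\<lambda>x. x)"
proof -
  have "Ck_on k S (\<lambda>x. x)" for k by (cases k) (auto simp: frechet_derivative_ident Ck_on_const)
  then show ?thesis by (simp add: smooth_on_def)
qed

lemma smooth_on_nth:
  fixes f :: "'v::real_normed_vector \<Rightarrow> ('w::real_normed_vector)^'n"
  assumes "open S" "smooth_on S f"
  shows "smooth_on S (\<lambda>x. f x $ k)"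
  using Ck_on_bounded_linear[OF bounded_linear_vec_nth assms(1)] assms(2) by (auto simp: smooth_on_def)

text \<open>The Jacobian matrix is the sum of its columns, each placed in position by a linear map.\<close>

lemma smooth_on_jacobian:
  fixes F :: "real^'n::finite \<Rightarrow> real^'m::finite"
  assumes "open S" "smooth_on S F"
  shows "smooth_on S (\<lambda>x. jacobian F (at x))"
proof -
  define L :: "'n \<Rightarrow> real^'m \<Rightarrow> real^'n^'m" where "L j v = (\<chi> a. v $ a *\<^sub>R axis j 1)" for j v
  have "linear (L j)" for j
    by (rule linearI) (auto simp: L_def vec_eq_iff algebra_simps)
  then have L: "bounded_linear (L j)" for j by (simp add: linear_conv_bounded_linear)
  have "jacobian F (at x) = (\<Sum>j\<in>UNIV. L j (frechet_derivative F (at x) (axis j 1)))" for x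
  proof -
    have "(\<Sum>j\<in>UNIV. w j * axis j 1 $ i) = w i" for w :: "'n \<Rightarrow> real" and i
      by (simp add: axis_def if_distrib cong: if_cong)
    then show ?thesis by (simp add: jacobian_def matrix_def L_def vec_eq_iff)
  qed
  moreover have "Ck_on k S (\<lambda>x. \<Sum>j\<in>UNIV. L j (frechet_derivative F (at x) (axis j 1)))" for k
    by (intro Ck_on_sum[OF assms(1)] Ck_on_bounded_linear[OF L assms(1)] finite)
      (use smooth_on_frechet[OF assms(2)] in \<open>simp add: smooth_on_def\<close>)
  ultimately show ?thesis by (simp add: smooth_on_def)
qed

lemma bounded_bilinear_matrix_mult:
  "bounded_bilinear ((**) :: real^'n::finite^'m::finite \<Rightarrow> real^'k::finite^'n \<Rightarrow> real^'k^'m)"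
  unfolding bilinear_conv_bounded_bilinear[symmetric] bilinear_def
  by (auto intro!: linearI simp: matrix_matrix_mult_def vec_eq_iff algebra_simps sum.distrib sum_distrib_left)

lemma bounded_linear_transpose:
  "bounded_linear (transpose :: real^'n::finite^'m::finite \<Rightarrow> real^'m^'n)"
  unfolding linear_conv_bounded_linear[symmetric]
  by (auto intro!: linearI simp: transpose_def vec_eq_iff)

section \<open>Partial derivatives in coordinates\<close>

lemma differentiable_componentwise_vec:
  fixes f :: "'v::real_normed_vector \<Rightarrow> real^'n::finite"
  assumes "\<And>k. (\<lambda>y. f y $ k) differentiable (at x)"
  shows "f differentiable (at x)"
proof -
  have "(\<lambda>y. (f y \<bullet> b)) differentiable (at x)" if "b \<in> Basis" for b
    using assms that by (auto simp: Basis_vec_def inner_axis)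
  then show ?thesis using differentiable_componentwise_within[of f x UNIV] by blast
qed

lemma smooth_on_pd: "smooth_on S f \<Longrightarrow> smooth_on S (pd i f)"
  unfolding pd_def[abs_def] by (rule smooth_on_frechet)

lemma pd_nth:
  fixes f :: "real^'n::finite \<Rightarrow> real^'m"
  shows "f differentiable (at x) \<Longrightarrow> pd i f x $ k = pd i (\<lambda>y. f y $ k) x"
  unfolding pd_def by (simp add: frechet_nth)

lemma pd_cong_open:
  "open S \<Longrightarrow> x \<in> S \<Longrightarrow> (\<And>y. y \<in> S \<Longrightarrow> f y = g y) \<Longrightarrow> pd i f x = pd i g x"
  unfolding pd_def using frechet_cong_open by metis

lemma pd_add: "f differentiable (at x) \<Longrightarrow> g differentiable (at x) \<Longrightarrow>
   pd i (\<lambda>y. f y + g y) x = pd i f x + pd i g x"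
  using frechet_derivative_at[OF has_derivative_add[of f "frechet_derivative f (at x)" "at x" g
      "frechet_derivative g (at x)"], symmetric]
  by (simp add: pd_def frechet_derivative_works)

lemma pd_const [simp]: "pd i (\<lambda>y. c) x = 0"
  by (simp add: pd_def)

lemma frechet_eq_sum_pd:
  assumes "f differentiable (at x)"
  shows "frechet_derivative f (at x) v = (\<Sum>a\<in>UNIV. v $ a *\<^sub>R pd a f x)"
proof -
  have lin: "linear (frechet_derivative f (at x))" by (rule linear_frechet_derivative[OF assms])
  have "frechet_derivative f (at x) (\<Sum>a\<in>UNIV. v $ a *\<^sub>R axis a 1) = (\<Sum>a\<in>UNIV. v $ a *\<^sub>R pd a f x)"
    by (simp only: linear_sum[OF lin] linear_cmul[OF lin] pd_def o_def)
  then show ?thesis using basis_expansion[of v] by (simp add: scalar_mult_eq_scaleR)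
qed

lemma pd_compose:
  fixes F :: "real^'n::finite \<Rightarrow> real^'m::finite" and \<phi> :: "real^'m \<Rightarrow> real"
  assumes F: "F differentiable (at x)" and \<phi>: "\<phi> differentiable (at (F x))"
  shows "pd i (\<lambda>y. \<phi> (F y)) x = (\<Sum>a\<in>UNIV. pd a \<phi> (F x) * pd i F x $ a)"
proof -
  have "((\<lambda>y. \<phi> (F y)) has_derivative
      (\<lambda>v. frechet_derivative \<phi> (at (F x)) (frechet_derivative F (at x) v))) (at x)"
    by (rule has_derivative_compose[OF F[unfolded frechet_derivative_works] \<phi>[unfolded frechet_derivative_works]])
  from frechet_derivative_at[OF this, symmetric]
  have "pd i (\<lambda>y. \<phi> (F y)) x = frechet_derivative \<phi> (at (F x)) (pd i F x)" by (simp add: pd_def)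
  also have "\<dots> = (\<Sum>a\<in>UNIV. pd i F x $ a *\<^sub>R pd a \<phi> (F x))" by (rule frechet_eq_sum_pd[OF \<phi>])
  finally show ?thesis by (simp add: mult.commute)
qed

lemma differentiable_compose_real:
  fixes F :: "real^'n::finite \<Rightarrow> real^'m::finite" and \<phi> :: "real^'m \<Rightarrow> real"
  assumes "F differentiable (at x)" and "\<phi> differentiable (at (F x))"
  shows "(\<lambda>y. \<phi> (F y)) differentiable (at x)"
  using differentiable_chain_at[OF assms] by (simp add: o_def)

section \<open>Algebra of metric and curvature at a point\<close>

lemma metric_inner_sum: "metric_inner G v w = (\<Sum>a\<in>UNIV. \<Sum>b\<in>UNIV. v $ a * G $ a $ b * w $ b)"
  by (simp add: metric_inner_def inner_vec_def matrix_vector_mult_def sum_distrib_left mult.assoc)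

lemma metric_inner_add:
  "metric_inner G (u + v) w = metric_inner G u w + metric_inner G v w"
  "metric_inner G w (u + v) = metric_inner G w u + metric_inner G w v"
  by (simp_all add: metric_inner_def inner_add_left inner_add_right matrix_vector_right_distrib)

lemma metric_inner_diff:
  "metric_inner G (u - v) w = metric_inner G u w - metric_inner G v w"
  by (simp add: metric_inner_def inner_diff_left)

lemma metric_inner_sum_left: "metric_inner G (\<Sum>i\<in>I. f i) w = (\<Sum>i\<in>I. metric_inner G (f i) w)"
  by (simp add: metric_inner_def inner_sum_left)

lemma metric_inner_scaleR:
  "metric_inner G (r *\<^sub>R u) w = r * metric_inner G u w"
  "metric_inner G w (r *\<^sub>R u) = r * metric_inner G w u"
  by (simp_all add: metric_inner_def matrix_vector_mult_scaleR)

lemma metric_inner_commute: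
  assumes "transpose G = G" shows "metric_inner G v w = metric_inner G w v"
proof -
  have G: "G $ a $ b = G $ b $ a" for a b
    using arg_cong[OF assms, of "\<lambda>G. G $ b $ a"] by (simp add: transpose_def)
  have "v $ a * G $ a $ b * w $ b = w $ b * G $ b $ a * v $ a" for a b
    by (subst G) simp
  then have "metric_inner G v w = (\<Sum>a\<in>UNIV. \<Sum>b\<in>UNIV. w $ b * G $ b $ a * v $ a)"
    unfolding metric_inner_sum by (intro sum.cong refl)
  also have "\<dots> = metric_inner G w v" unfolding metric_inner_sum by (rule sum.swap)
  finally show ?thesis .
qed

definition Riem_form :: "(real^'m::finite \<Rightarrow> real^'m^'m) \<Rightarrow> real^'m \<Rightarrow>
    real^'m \<Rightarrow> real^'m \<Rightarrow> real^'m \<Rightarrow> real^'m \<Rightarrow> real" where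
  "Riem_form g y X Y V W =
     (\<Sum>a\<in>UNIV. \<Sum>b\<in>UNIV. \<Sum>c\<in>UNIV. \<Sum>d\<in>UNIV. Riem g y a b c d * X $ a * Y $ b * V $ c * W $ d)"

lemma sum_axis:
  fixes w :: "'n::finite \<Rightarrow> real"
  shows "(\<Sum>a\<in>UNIV. w a * axis i 1 $ a) = w i" "(\<Sum>a\<in>UNIV. axis i 1 $ a * w a) = w i"
  by (simp_all add: axis_def if_distrib if_distribR cong: if_cong)

lemma metric_inner_axis: "metric_inner G v (axis l 1) = (\<Sum>p\<in>UNIV. v $ p * G $ p $ l)"
  by (simp add: metric_inner_sum sum_axis)

lemma metric_inner_axis_axis: "metric_inner G (axis i 1) (axis j 1) = G $ i $ j"
  by (simp add: metric_inner_axis sum_axis)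

lemma Riem_form_axis: "Riem_form g y (axis i 1) (axis j 1) (axis k 1) (axis l 1) = Riem g y i j k l"
proof -
  have "Riem_form g y (axis i 1) (axis j 1) (axis k 1) (axis l 1)
     = (\<Sum>a\<in>UNIV. (\<Sum>b\<in>UNIV. (\<Sum>c\<in>UNIV. (\<Sum>d\<in>UNIV. Riem g y a b c d * axis l 1 $ d)
         * axis k 1 $ c) * axis j 1 $ b) * axis i 1 $ a)"
    unfolding Riem_form_def sum_distrib_right by (intro sum.cong refl) (simp only: mult_ac)
  then show ?thesis by (simp only: sum_axis)
qed

lemma Riem_form_constant_curvature:
  assumes "transpose (g y) = g y" and "\<And>i j k l. Riem g y i j k l = K * owedge (g y) i j k l"
  shows "Riem_form g y X Y V W = K * (metric_inner (g y) V X * metric_inner (g y) Y W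
           - metric_inner (g y) V Y * metric_inner (g y) X W)"
proof -
  let ?G = "g y"
  have 1: "metric_inner ?G V X * metric_inner ?G Y W
      = (\<Sum>a\<in>UNIV. \<Sum>b\<in>UNIV. \<Sum>c\<in>UNIV. \<Sum>d\<in>UNIV. ?G $ c $ a * ?G $ b $ d * X $ a * Y $ b * V $ c * W $ d)"
    for X Y
  proof -
    have "metric_inner ?G V X * metric_inner ?G Y W
      = (\<Sum>c\<in>UNIV. \<Sum>a\<in>UNIV. \<Sum>b\<in>UNIV. \<Sum>d\<in>UNIV. ?G $ c $ a * ?G $ b $ d * X $ a * Y $ b * V $ c * W $ d)"
      unfolding metric_inner_sum unfolding sum_distrib_right unfolding sum_distrib_left
      by (intro sum.cong refl) (simp add: mult_ac)
    also have "\<dots> = (\<Sum>a\<in>UNIV. \<Sum>c\<in>UNIV. \<Sum>b\<in>UNIV. \<Sum>d\<in>UNIV. ?G $ c $ a * ?G $ b $ d * X $ a * Y $ b * V $ c * W $ d)"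
      by (rule sum.swap)
    also have "\<dots> = (\<Sum>a\<in>UNIV. \<Sum>b\<in>UNIV. \<Sum>c\<in>UNIV. \<Sum>d\<in>UNIV. ?G $ c $ a * ?G $ b $ d * X $ a * Y $ b * V $ c * W $ d)"
      by (intro sum.cong refl sum.swap)
    finally show ?thesis .
  qed
  have 2: "metric_inner ?G V Y * metric_inner ?G X W
      = (\<Sum>a\<in>UNIV. \<Sum>b\<in>UNIV. \<Sum>c\<in>UNIV. \<Sum>d\<in>UNIV. ?G $ c $ b * ?G $ a $ d * X $ a * Y $ b * V $ c * W $ d)"
    unfolding 1[of Y X] by (subst sum.swap) (intro sum.cong refl, simp add: mult_ac)
  show ?thesis
    unfolding 1[of X Y] 2 Riem_form_def assms(2) owedge_def
    by (simp add: sum_subtractf[symmetric] sum_distrib_left left_diff_distrib right_diff_distrib mult.assoc)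
qed

section \<open>Covariant differentiation along a map\<close>

text \<open>A smooth map into a domain carrying a metric. Two instances are compared below: an immersion
  into the ambient space, and the identity map with the induced metric, for which covariant
  differentiation along the map is the intrinsic Levi-Civita connection.\<close>

locale map_into_metric =
  fixes U :: "(real^'n::finite) set" and F :: "real^'n \<Rightarrow> real^'m::finite"
    and W :: "(real^'m) set" and g :: "real^'m \<Rightarrow> real^'m^'m"
  assumes open_U: "open U" and open_W: "open W"
    and smooth_F: "smooth_on U F" and F_in: "x \<in> U \<Longrightarrow> F x \<in> W"
    and smooth_g: "smooth_on W g"
    and sym_g: "y \<in> W \<Longrightarrow> transpose (g y) = g y" and inv_g: "y \<in> W \<Longrightarrow> invertible (g y)"
begin

abbreviation nabla :: "'n \<Rightarrow> (real^'n \<Rightarrow> real^'m) \<Rightarrow> real^'n \<Rightarrow> real^'m" where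
  "nabla i V x \<equiv> cov_along g F V x (axis i 1)"

lemma F_diff: "x \<in> U \<Longrightarrow> F differentiable (at x)"
  using smooth_on_differentiable[OF smooth_F] .

lemma pd_F_diff: "x \<in> U \<Longrightarrow> pd i F differentiable (at x)"
  using smooth_on_differentiable[OF smooth_on_pd[OF smooth_F]] .

lemma christoffel_sym: "y \<in> W \<Longrightarrow> christoffel g y a b e = christoffel g y b a e"
  using christoffel_iff_levi_civita[where h = g and G = "christoffel g y", OF open_W _ sym_g inv_g] by blast

lemma metric_compatible: "y \<in> W \<Longrightarrow> pd c (\<lambda>y. g y $ a $ b) y
   = (\<Sum>e\<in>UNIV. christoffel g y c a e * g y $ e $ b) + (\<Sum>e\<in>UNIV. christoffel g y c b e * g y $ a $ e)"
  using christoffel_iff_levi_civita[where h = g and G = "christoffel g y", OF open_W _ sym_g inv_g] by blast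

lemma christoffel_F_diff: "x \<in> U \<Longrightarrow> (\<lambda>y. christoffel g (F y) a b e) differentiable (at x)"
  using differentiable_compose_real[OF F_diff christoffel_differentiable[OF open_W F_in smooth_g inv_g]] by blast

lemma nabla_nth: "nabla i V x $ e = pd i V x $ e
    + (\<Sum>a\<in>UNIV. \<Sum>b\<in>UNIV. christoffel g (F x) a b e * pd i F x $ a * V x $ b)"
  by (simp add: cov_along_def pd_def)

lemma nabla_diff:
  assumes "x \<in> U" "smooth_on U V"
  shows "nabla i V differentiable (at x)"
proof (rule differentiable_componentwise_vec)
  fix e show "(\<lambda>y. nabla i V y $ e) differentiable (at x)"
    unfolding nabla_nth
    by (intro differentiable_add differentiable_sum differentiable_mult differentiable_nth
        christoffel_F_diff pd_F_diff assms ballI finite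
        smooth_on_differentiable[OF smooth_on_pd[OF assms(2)]] smooth_on_differentiable[OF assms(2)])
qed

text \<open>The Leibniz rule for the inner product of two fields along the map: the chain rule turns the
  derivative of \<open>g \<circ> F\<close> into derivatives of \<open>g\<close>, and metric compatibility of the Christoffel symbols
  splits these into the two correction terms.\<close>

lemma pd_metric_inner:
  assumes x: "x \<in> U" and V: "V differentiable (at x)" and V': "V' differentiable (at x)"
  shows "pd i (\<lambda>y. metric_inner (g (F y)) (V y) (V' y)) x
    = metric_inner (g (F x)) (nabla i V x) (V' x) + metric_inner (g (F x)) (V x) (nabla i V' x)"
proof -
  let ?\<Gamma> = "christoffel g (F x)" and ?G = "g (F x)" and ?f = "pd i F x" and ?v = "V x" and ?w = "V' x"
  have dg: "(\<lambda>z. g z $ a $ b) differentiable (at (F x))" for a b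
    by (intro differentiable_nth smooth_on_differentiable[OF smooth_g] F_in x)
  have dgF: "(\<lambda>y. g (F y) $ a $ b) differentiable (at x)" for a b
    by (rule differentiable_compose_real[OF F_diff[OF x] dg])
  have pg: "pd i (\<lambda>y. g (F y) $ a $ b) x = (\<Sum>c\<in>UNIV. \<Sum>e\<in>UNIV. ?\<Gamma> c a e * ?G $ e $ b * ?f $ c)
      + (\<Sum>c\<in>UNIV. \<Sum>e\<in>UNIV. ?\<Gamma> c b e * ?G $ a $ e * ?f $ c)" for a b
    by (simp add: pd_compose[OF F_diff[OF x] dg] metric_compatible[OF F_in[OF x]]
        distrib_right sum.distrib sum_distrib_right)
  have "pd i (\<lambda>y. metric_inner (g (F y)) (V y) (V' y)) x
     = (\<Sum>a\<in>UNIV. \<Sum>b\<in>UNIV. pd i (\<lambda>y. V y $ a * g (F y) $ a $ b * V' y $ b) x)"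
    unfolding metric_inner_sum
    by (simp add: pd_sum differentiable_sum differentiable_mult differentiable_nth V V' dgF)
  also have "\<dots> = (\<Sum>a\<in>UNIV. \<Sum>b\<in>UNIV. pd i V x $ a * ?G $ a $ b * ?w $ b)
     + (\<Sum>a\<in>UNIV. \<Sum>b\<in>UNIV. ?v $ a * ?G $ a $ b * pd i V' x $ b)
     + (\<Sum>a\<in>UNIV. \<Sum>b\<in>UNIV. ?v $ a * pd i (\<lambda>y. g (F y) $ a $ b) x * ?w $ b)"
    unfolding sum.distrib[symmetric]
    by (intro sum.cong refl)
      (simp add: pd_mult differentiable_mult differentiable_nth V V' dgF pd_nth algebra_simps)
  also have "(\<Sum>a\<in>UNIV. \<Sum>b\<in>UNIV. ?v $ a * pd i (\<lambda>y. g (F y) $ a $ b) x * ?w $ b)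
     = (\<Sum>a\<in>UNIV. \<Sum>b\<in>UNIV. \<Sum>c\<in>UNIV. \<Sum>e\<in>UNIV. ?\<Gamma> c a e * ?f $ c * ?v $ a * ?G $ e $ b * ?w $ b)
     + (\<Sum>a\<in>UNIV. \<Sum>b\<in>UNIV. \<Sum>c\<in>UNIV. \<Sum>e\<in>UNIV. ?v $ a * ?G $ a $ e * (?\<Gamma> c b e * ?f $ c * ?w $ b))"
    unfolding pg by (simp add: sum.distrib[symmetric] sum_distrib_left sum_distrib_right distrib_left distrib_right mult_ac)
  also have "(\<Sum>a\<in>UNIV. \<Sum>b\<in>UNIV. \<Sum>c\<in>UNIV. \<Sum>e\<in>UNIV. ?\<Gamma> c a e * ?f $ c * ?v $ a * ?G $ e $ b * ?w $ b)
     = (\<Sum>e\<in>UNIV. \<Sum>b\<in>UNIV. (\<Sum>c\<in>UNIV. \<Sum>a\<in>UNIV. ?\<Gamma> c a e * ?f $ c * ?v $ a) * ?G $ e $ b * ?w $ b)"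
  proof -
    let ?t = "\<lambda>a b c e. ?\<Gamma> c a e * ?f $ c * ?v $ a * ?G $ e $ b * ?w $ b"
    have "(\<Sum>a\<in>UNIV. \<Sum>b\<in>UNIV. \<Sum>c\<in>UNIV. \<Sum>e\<in>UNIV. ?t a b c e)
        = (\<Sum>a\<in>UNIV. \<Sum>b\<in>UNIV. \<Sum>e\<in>UNIV. \<Sum>c\<in>UNIV. ?t a b c e)"
      by (intro sum.cong refl sum.swap)
    also have "\<dots> = (\<Sum>a\<in>UNIV. \<Sum>e\<in>UNIV. \<Sum>b\<in>UNIV. \<Sum>c\<in>UNIV. ?t a b c e)"
      by (intro sum.cong refl sum.swap)
    also have "\<dots> = (\<Sum>e\<in>UNIV. \<Sum>a\<in>UNIV. \<Sum>b\<in>UNIV. \<Sum>c\<in>UNIV. ?t a b c e)"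
      by (rule sum.swap)
    also have "\<dots> = (\<Sum>e\<in>UNIV. \<Sum>b\<in>UNIV. \<Sum>a\<in>UNIV. \<Sum>c\<in>UNIV. ?t a b c e)"
      by (intro sum.cong refl sum.swap)
    also have "\<dots> = (\<Sum>e\<in>UNIV. \<Sum>b\<in>UNIV. \<Sum>c\<in>UNIV. \<Sum>a\<in>UNIV. ?t a b c e)"
      by (intro sum.cong refl sum.swap)
    finally show ?thesis by (simp only: sum_distrib_right)
  qed
  also have "(\<Sum>a\<in>UNIV. \<Sum>b\<in>UNIV. \<Sum>c\<in>UNIV. \<Sum>e\<in>UNIV. ?v $ a * ?G $ a $ e * (?\<Gamma> c b e * ?f $ c * ?w $ b))
     = (\<Sum>a\<in>UNIV. \<Sum>e\<in>UNIV. ?v $ a * ?G $ a $ e * (\<Sum>c\<in>UNIV. \<Sum>b\<in>UNIV. ?\<Gamma> c b e * ?f $ c * ?w $ b))"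
  proof -
    let ?t = "\<lambda>a b c e. ?v $ a * ?G $ a $ e * (?\<Gamma> c b e * ?f $ c * ?w $ b)"
    have "(\<Sum>a\<in>UNIV. \<Sum>b\<in>UNIV. \<Sum>c\<in>UNIV. \<Sum>e\<in>UNIV. ?t a b c e)
        = (\<Sum>a\<in>UNIV. \<Sum>b\<in>UNIV. \<Sum>e\<in>UNIV. \<Sum>c\<in>UNIV. ?t a b c e)"
      by (intro sum.cong refl sum.swap)
    also have "\<dots> = (\<Sum>a\<in>UNIV. \<Sum>e\<in>UNIV. \<Sum>b\<in>UNIV. \<Sum>c\<in>UNIV. ?t a b c e)"
      by (intro sum.cong refl sum.swap)
    also have "\<dots> = (\<Sum>a\<in>UNIV. \<Sum>e\<in>UNIV. \<Sum>c\<in>UNIV. \<Sum>b\<in>UNIV. ?t a b c e)"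
      by (intro sum.cong refl sum.swap)
    finally show ?thesis by (simp only: sum_distrib_left)
  qed
  finally show ?thesis
    unfolding metric_inner_sum nabla_nth
    by (simp add: distrib_left distrib_right sum.distrib)
qed

lemma pd_pd_commute:
  fixes V :: "real^'n \<Rightarrow> real^'k"
  assumes "x \<in> U" "smooth_on U V"
  shows "pd i (pd j V) x $ e = pd j (pd i V) x $ e"
proof -
  have d: "V differentiable (at y)" if "y \<in> U" for y
    using smooth_on_differentiable assms(2) that by blast
  have "pd i (pd j V) x $ e = pd i (pd j (\<lambda>y. V y $ e)) x" for i j
    using assms open_U by (subst pd_nth) (auto intro!: smooth_on_differentiable[OF smooth_on_pd] pd_cong_open pd_nth d)
  then show ?thesis using pd_commute[OF open_U assms(1) smooth_on_nth[OF open_U assms(2)]] by simp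
qed

text \<open>In the commutator the second derivatives of \<open>V\<close> and of \<open>F\<close> cancel because partial derivatives
  commute, and the terms containing one derivative of \<open>V\<close> cancel because they are symmetric in the
  two directions. What remains is \<open>d\<Gamma> + \<Gamma>\<Gamma>\<close>, the coordinate expression of the ambient curvature,
  evaluated on the two image directions.\<close>

lemma nabla_commutator:
  assumes x: "x \<in> U" and V: "smooth_on U V"
  shows "nabla i (nabla j V) x $ e - nabla j (nabla i V) x $ e
    = (\<Sum>a\<in>UNIV. \<Sum>b\<in>UNIV. \<Sum>c\<in>UNIV. curv g (F x) a b c e * pd i F x $ a * pd j F x $ b * V x $ c)"
proof -
  let ?\<Gamma> = "christoffel g (F x)" and ?v = "V x"
  define f where "f i = pd i F x" for i
  define d\<Gamma> where "d\<Gamma> c a b e = pd c (\<lambda>y. christoffel g y a b e) (F x)" for c a b e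
  have d\<Gamma>': "(\<lambda>y. christoffel g y a b e) differentiable (at (F x))" for a b e
    by (rule christoffel_differentiable[OF open_W F_in[OF x] smooth_g inv_g])
  note diffs = differentiable_mult differentiable_nth christoffel_F_diff[OF x] pd_F_diff[OF x]
    smooth_on_differentiable[OF V x] smooth_on_differentiable[OF smooth_on_pd[OF V] x]
  \<comment> \<open>The pieces of a second covariant derivative: \<open>A\<close> differentiates the Christoffel symbols, \<open>B\<close> the
    direction field, \<open>C\<close> the field \<open>V\<close>, and \<open>E\<close> is quadratic in the Christoffel symbols.\<close>
  define A where "A i j = (\<Sum>a\<in>UNIV. \<Sum>b\<in>UNIV. (\<Sum>c\<in>UNIV. d\<Gamma> c a b e * f i $ c) * f j $ a * ?v $ b)" for i j
  define B where "B i j = (\<Sum>a\<in>UNIV. \<Sum>b\<in>UNIV. ?\<Gamma> a b e * pd i (pd j F) x $ a * ?v $ b)" for i j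
  define C where "C i j = (\<Sum>a\<in>UNIV. \<Sum>b\<in>UNIV. ?\<Gamma> a b e * f j $ a * pd i V x $ b)" for i j
  define E where "E i j = (\<Sum>a\<in>UNIV. \<Sum>b\<in>UNIV. ?\<Gamma> a b e * f i $ a *
      (\<Sum>c\<in>UNIV. \<Sum>d\<in>UNIV. ?\<Gamma> c d b * f j $ c * ?v $ d))" for i j
  have p\<Gamma>: "pd i (\<lambda>y. christoffel g (F y) a b e) x = (\<Sum>c\<in>UNIV. d\<Gamma> c a b e * f i $ c)" for i a b
    unfolding d\<Gamma>_def f_def by (rule pd_compose[OF F_diff[OF x] d\<Gamma>'])
  have expand: "nabla i (nabla j V) x $ e = pd i (pd j V) x $ e + A i j + B i j + C i j + C j i + E i j" for i j
  proof -
    have "pd i (nabla j V) x $ e = pd i (\<lambda>y. pd j V y $ e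
      + (\<Sum>a\<in>UNIV. \<Sum>b\<in>UNIV. christoffel g (F y) a b e * pd j F y $ a * V y $ b)) x"
      by (simp add: pd_nth[OF nabla_diff[OF x V]] nabla_nth)
    also have "\<dots> = pd i (pd j V) x $ e
      + (\<Sum>a\<in>UNIV. \<Sum>b\<in>UNIV. pd i (\<lambda>y. christoffel g (F y) a b e * pd j F y $ a * V y $ b) x)"
      by (simp add: pd_add pd_sum pd_nth[symmetric] differentiable_sum diffs)
    also have "(\<Sum>a\<in>UNIV. \<Sum>b\<in>UNIV. pd i (\<lambda>y. christoffel g (F y) a b e * pd j F y $ a * V y $ b) x)
       = A i j + B i j + C i j"
      unfolding A_def B_def C_def sum.distrib[symmetric] f_def[of j]
      by (intro sum.cong refl) (simp add: pd_mult diffs p\<Gamma> pd_nth[symmetric] algebra_simps)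
    finally have "pd i (nabla j V) x $ e = pd i (pd j V) x $ e + (A i j + B i j + C i j)" .
    moreover have "(\<Sum>a\<in>UNIV. \<Sum>b\<in>UNIV. ?\<Gamma> a b e * pd i F x $ a * nabla j V x $ b) = C j i + E i j"
      unfolding nabla_nth C_def E_def f_def sum.distrib[symmetric] by (simp add: distrib_left)
    ultimately show ?thesis by (subst nabla_nth) simp
  qed
  have BB: "B i j = B j i"
    unfolding B_def using pd_pd_commute[OF x smooth_F, of i j] by simp
  have A1: "A i j = (\<Sum>a\<in>UNIV. \<Sum>b\<in>UNIV. \<Sum>c\<in>UNIV. d\<Gamma> a b c e * f i $ a * f j $ b * ?v $ c)" for i j
  proof -
    let ?t = "\<lambda>a b c. d\<Gamma> a b c e * f i $ a * f j $ b * ?v $ c"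
    have "A i j = (\<Sum>b\<in>UNIV. \<Sum>c\<in>UNIV. \<Sum>a\<in>UNIV. ?t a b c)"
      by (simp add: A_def sum_distrib_right)
    also have "\<dots> = (\<Sum>b\<in>UNIV. \<Sum>a\<in>UNIV. \<Sum>c\<in>UNIV. ?t a b c)" by (intro sum.cong refl sum.swap)
    also have "\<dots> = (\<Sum>a\<in>UNIV. \<Sum>b\<in>UNIV. \<Sum>c\<in>UNIV. ?t a b c)" by (rule sum.swap)
    finally show ?thesis .
  qed
  have A2: "A j i = (\<Sum>a\<in>UNIV. \<Sum>b\<in>UNIV. \<Sum>c\<in>UNIV. d\<Gamma> b a c e * f i $ a * f j $ b * ?v $ c)"
    unfolding A1[of j i] by (subst sum.swap) (simp add: mult_ac)
  have E1: "E i j = (\<Sum>a\<in>UNIV. \<Sum>b\<in>UNIV. \<Sum>c\<in>UNIV. (\<Sum>q\<in>UNIV. ?\<Gamma> b c q * ?\<Gamma> a q e) * f i $ a * f j $ b * ?v $ c)"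
    for i j
  proof -
    let ?t = "\<lambda>a b c q. ?\<Gamma> b c q * ?\<Gamma> a q e * f i $ a * f j $ b * ?v $ c"
    have "E i j = (\<Sum>a\<in>UNIV. \<Sum>q\<in>UNIV. \<Sum>b\<in>UNIV. \<Sum>c\<in>UNIV. ?t a b c q)"
      by (simp add: E_def sum_distrib_left mult_ac)
    also have "\<dots> = (\<Sum>a\<in>UNIV. \<Sum>b\<in>UNIV. \<Sum>q\<in>UNIV. \<Sum>c\<in>UNIV. ?t a b c q)" by (intro sum.cong refl sum.swap)
    also have "\<dots> = (\<Sum>a\<in>UNIV. \<Sum>b\<in>UNIV. \<Sum>c\<in>UNIV. \<Sum>q\<in>UNIV. ?t a b c q)" by (intro sum.cong refl sum.swap)
    finally show ?thesis by (simp add: sum_distrib_right)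
  qed
  have E2: "E j i = (\<Sum>a\<in>UNIV. \<Sum>b\<in>UNIV. \<Sum>c\<in>UNIV. (\<Sum>q\<in>UNIV. ?\<Gamma> a c q * ?\<Gamma> b q e) * f i $ a * f j $ b * ?v $ c)"
    unfolding E1[of j i] by (subst sum.swap) (simp add: mult_ac)
  have "nabla i (nabla j V) x $ e - nabla j (nabla i V) x $ e = A i j - A j i + (E i j - E j i)"
    unfolding expand using BB pd_pd_commute[OF x V, of i j e] by simp
  also have "\<dots> = (\<Sum>a\<in>UNIV. \<Sum>b\<in>UNIV. \<Sum>c\<in>UNIV. curv g (F x) a b c e * f i $ a * f j $ b * ?v $ c)"
    unfolding A1[of i j] A2 E1[of i j] E2 sum_subtractf[symmetric] sum.distrib[symmetric]
    by (simp add: curv_christoffel[OF open_W F_in[OF x] smooth_g sym_g inv_g] d\<Gamma>_def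
        sum_subtractf left_diff_distrib distrib_right)
  finally show ?thesis unfolding f_def .
qed

text \<open>The curvature paired with a second field \<open>V'\<close>. Moving the outer derivative off
  \<open>\<nabla>\<^sub>i\<nabla>\<^sub>jV\<close> by the Leibniz rule expresses the curvature through derivatives of scalar functions and
  inner products of first covariant derivatives only. Both are preserved, up to normal terms, by an
  isometric immersion, so this form transfers directly between the submanifold and the ambient
  space.\<close>

lemma Riem_form_along:
  assumes x: "x \<in> U" and V: "smooth_on U V" and V': "smooth_on U V'"
  shows "Riem_form g (F x) (pd i F x) (pd j F x) (V x) (V' x)
    = (pd i (\<lambda>y. metric_inner (g (F y)) (nabla j V y) (V' y)) x
        - metric_inner (g (F x)) (nabla j V x) (nabla i V' x))
    - (pd j (\<lambda>y. metric_inner (g (F y)) (nabla i V y) (V' y)) x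
        - metric_inner (g (F x)) (nabla i V x) (nabla j V' x))"
proof -
  let ?G = "g (F x)" and ?R = "curv g (F x)" and ?X = "pd i F x" and ?Y = "pd j F x" and ?v = "V x" and ?w = "V' x"
  have dV': "V' differentiable (at x)" using smooth_on_differentiable[OF V' x] .
  have "pd i (\<lambda>y. metric_inner (g (F y)) (nabla j V y) (V' y)) x - metric_inner ?G (nabla j V x) (nabla i V' x)
      = metric_inner ?G (nabla i (nabla j V) x) ?w" for i j
    using pd_metric_inner[OF x nabla_diff[OF x V] dV'] by simp
  then have "?thesis \<longleftrightarrow> Riem_form g (F x) ?X ?Y ?v ?w
      = metric_inner ?G (nabla i (nabla j V) x - nabla j (nabla i V) x) ?w"
    by (simp add: metric_inner_diff)
  moreover have "metric_inner ?G (nabla i (nabla j V) x - nabla j (nabla i V) x) ?w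
      = (\<Sum>e\<in>UNIV. \<Sum>d\<in>UNIV. \<Sum>a\<in>UNIV. \<Sum>b\<in>UNIV. \<Sum>c\<in>UNIV. ?R a b c e * ?G $ e $ d * ?X $ a * ?Y $ b * ?v $ c * ?w $ d)"
    unfolding metric_inner_sum vector_minus_component nabla_commutator[OF x V] sum_distrib_right
    by (intro sum.cong refl) (simp only: mult_ac)
  moreover have "\<dots> = Riem_form g (F x) ?X ?Y ?v ?w"
  proof -
    let ?t = "\<lambda>e d a b c. ?R a b c e * ?G $ e $ d * ?X $ a * ?Y $ b * ?v $ c * ?w $ d"
    have "(\<Sum>e\<in>UNIV. \<Sum>d\<in>UNIV. \<Sum>a\<in>UNIV. \<Sum>b\<in>UNIV. \<Sum>c\<in>UNIV. ?t e d a b c)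
       = (\<Sum>e\<in>UNIV. \<Sum>a\<in>UNIV. \<Sum>d\<in>UNIV. \<Sum>b\<in>UNIV. \<Sum>c\<in>UNIV. ?t e d a b c)" by (intro sum.cong refl sum.swap)
    also have "\<dots> = (\<Sum>e\<in>UNIV. \<Sum>a\<in>UNIV. \<Sum>b\<in>UNIV. \<Sum>d\<in>UNIV. \<Sum>c\<in>UNIV. ?t e d a b c)" by (intro sum.cong refl sum.swap)
    also have "\<dots> = (\<Sum>e\<in>UNIV. \<Sum>a\<in>UNIV. \<Sum>b\<in>UNIV. \<Sum>c\<in>UNIV. \<Sum>d\<in>UNIV. ?t e d a b c)" by (intro sum.cong refl sum.swap)
    also have "\<dots> = (\<Sum>a\<in>UNIV. \<Sum>e\<in>UNIV. \<Sum>b\<in>UNIV. \<Sum>c\<in>UNIV. \<Sum>d\<in>UNIV. ?t e d a b c)" by (rule sum.swap)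
    also have "\<dots> = (\<Sum>a\<in>UNIV. \<Sum>b\<in>UNIV. \<Sum>e\<in>UNIV. \<Sum>c\<in>UNIV. \<Sum>d\<in>UNIV. ?t e d a b c)" by (intro sum.cong refl sum.swap)
    also have "\<dots> = (\<Sum>a\<in>UNIV. \<Sum>b\<in>UNIV. \<Sum>c\<in>UNIV. \<Sum>e\<in>UNIV. \<Sum>d\<in>UNIV. ?t e d a b c)" by (intro sum.cong refl sum.swap)
    also have "\<dots> = (\<Sum>a\<in>UNIV. \<Sum>b\<in>UNIV. \<Sum>c\<in>UNIV. \<Sum>d\<in>UNIV. \<Sum>e\<in>UNIV. ?t e d a b c)" by (intro sum.cong refl sum.swap)
    finally show ?thesis unfolding Riem_form_def Riem_def by (simp only: sum_distrib_right)
  qed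
  ultimately show ?thesis by simp
qed

end

section \<open>The Gauss and Codazzi equations\<close>

text \<open>A hypersurface in coordinates, with induced metric \<open>h\<close>, normal field \<open>Z\<close> of constant length and
  second fundamental form \<open>P\<close>. Since \<open>Z\<close> is orthogonal to the image, \<open>P\<^sub>i\<^sub>j Z\<close> is the normal part of
  \<open>\<nabla>\<^sub>i \<partial>\<^sub>jF\<close> exactly when their difference is tangent, which is the last assumption.\<close>

locale nondegenerate_hypersurface = map_into_metric U F W g
  for U :: "(real^'n::finite) set" and F :: "real^'n \<Rightarrow> real^'m::finite"
    and W :: "(real^'m) set" and g :: "real^'m \<Rightarrow> real^'m^'m" +
  fixes h P :: "real^'n \<Rightarrow> real^'n^'n" and Z :: "real^'n \<Rightarrow> real^'m" and \<epsilon> :: real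
  assumes smooth_h: "smooth_on U h" and inv_h: "x \<in> U \<Longrightarrow> invertible (h x)"
    and h_induced: "x \<in> U \<Longrightarrow> h x $ i $ j = metric_inner (g (F x)) (pd i F x) (pd j F x)"
    and inj_dF: "x \<in> U \<Longrightarrow> inj (frechet_derivative F (at x))"
    and smooth_P: "smooth_on U P" and sym_P: "x \<in> U \<Longrightarrow> P x $ i $ j = P x $ j $ i"
    and smooth_Z: "smooth_on U Z"
    and Z_orth: "x \<in> U \<Longrightarrow> metric_inner (g (F x)) (Z x) (pd i F x) = 0"
    and Z_unit: "x \<in> U \<Longrightarrow> metric_inner (g (F x)) (Z x) (Z x) = \<epsilon>"
    and second_ff: "x \<in> U \<Longrightarrow> cov_along g F (pd j F) x (axis i 1) - P x $ i $ j *\<^sub>R Z x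
        \<in> range (frechet_derivative F (at x))"
begin

lemma sym_h: "x \<in> U \<Longrightarrow> transpose (h x) = h x"
  using metric_inner_commute[OF sym_g[OF F_in]]
  by (auto simp: vec_eq_iff transpose_def h_induced)

sublocale intrinsic: map_into_metric U "\<lambda>y. y" U h
  by unfold_locales (auto intro: open_U smooth_h sym_h inv_h)

lemma intrinsic_nabla_axis:
  "intrinsic.nabla i (\<lambda>_. axis j 1) x = (\<chi> k. christoffel h x i j k)"
proof -
  have "pd i (\<lambda>y. y) x = axis i 1" by (simp add: pd_def frechet_derivative_ident)
  then show ?thesis by (simp add: vec_eq_iff intrinsic.nabla_nth sum_axis)
qed

lemma dF_sum: "x \<in> U \<Longrightarrow> frechet_derivative F (at x) v = (\<Sum>a\<in>UNIV. v $ a *\<^sub>R pd a F x)"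
  by (rule frechet_eq_sum_pd[OF F_diff])

lemma inner_dF_left:
  "x \<in> U \<Longrightarrow> metric_inner (g (F x)) (frechet_derivative F (at x) v) w
     = (\<Sum>a\<in>UNIV. v $ a * metric_inner (g (F x)) (pd a F x) w)"
  by (simp add: dF_sum metric_inner_sum_left metric_inner_scaleR)

lemma inner_dF_dF:
  assumes x: "x \<in> U"
  shows "metric_inner (g (F x)) (frechet_derivative F (at x) v) (frechet_derivative F (at x) w)
     = metric_inner (h x) v w"
proof -
  have "metric_inner (g (F x)) (pd a F x) (frechet_derivative F (at x) w)
      = (\<Sum>b\<in>UNIV. w $ b * h x $ a $ b)" for a
    using inner_dF_left[OF x, of w "pd a F x"] metric_inner_commute[OF sym_g[OF F_in[OF x]]]
    by (simp add: h_induced[OF x])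
  then show ?thesis
    unfolding inner_dF_left[OF x] metric_inner_sum[of "h x"] by (simp add: sum_distrib_left mult_ac)
qed

lemma Z_dF:
  assumes "x \<in> U"
  shows "metric_inner (g (F x)) (frechet_derivative F (at x) v) (Z x) = 0"
    and "metric_inner (g (F x)) (Z x) (frechet_derivative F (at x) v) = 0"
proof -
  have "metric_inner (g (F x)) (pd a F x) (Z x) = 0" for a
    using Z_orth[OF assms] metric_inner_commute[OF sym_g[OF F_in[OF assms]], of "pd a F x" "Z x"] by simp
  then show "metric_inner (g (F x)) (frechet_derivative F (at x) v) (Z x) = 0"
    by (simp add: inner_dF_left[OF assms])
  then show "metric_inner (g (F x)) (Z x) (frechet_derivative F (at x) v) = 0"
    using metric_inner_commute[OF sym_g[OF F_in[OF assms]]] by metis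
qed

lemma nabla_pd_commute:
  assumes "x \<in> U" shows "nabla i (pd j F) x = nabla j (pd i F) x"
proof -
  have "(\<Sum>a\<in>UNIV. \<Sum>b\<in>UNIV. christoffel g (F x) a b e * pd i F x $ a * pd j F x $ b)
     = (\<Sum>a\<in>UNIV. \<Sum>b\<in>UNIV. christoffel g (F x) a b e * pd j F x $ a * pd i F x $ b)" for e
    by (subst sum.swap) (simp add: christoffel_sym[OF F_in[OF assms], of _ _ e] mult_ac)
  then show ?thesis
    by (simp add: vec_eq_iff nabla_nth pd_pd_commute[OF assms smooth_F, of i j])
qed

text \<open>The tangential part of \<open>\<nabla>\<^sub>i \<partial>\<^sub>jF\<close> has some coefficients \<open>D\<^sub>i\<^sub>j\<^sup>k\<close> in the frame \<open>\<partial>\<^sub>kF\<close>. As the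
  frame is independent, they are symmetric because the second derivatives of \<open>F\<close>, the ambient
  Christoffel symbols and \<open>P\<close> are. They are compatible with \<open>h\<close> by the ambient Leibniz rule.
  Uniqueness of the Levi-Civita connection identifies them with the Christoffel symbols of \<open>h\<close>.\<close>

lemma Gauss_formula:
  assumes x: "x \<in> U"
  shows "nabla i (pd j F) x = frechet_derivative F (at x) (intrinsic.nabla i (\<lambda>_. axis j 1) x)
     + P x $ i $ j *\<^sub>R Z x"
proof -
  let ?dF = "frechet_derivative F (at x)"
  have "\<forall>i j. \<exists>w. nabla i (pd j F) x - P x $ i $ j *\<^sub>R Z x = ?dF w"
    using second_ff[OF x] by blast
  then obtain D where D: "\<And>i j. nabla i (pd j F) x - P x $ i $ j *\<^sub>R Z x = ?dF (D i j)" by metis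
  have torsion: "D i j = D j i" for i j
    using D[of i j] D[of j i] nabla_pd_commute[OF x, of i j] sym_P[OF x, of i j] inj_dF[OF x]
    by (metis injD)
  have inner: "metric_inner (g (F x)) (nabla k (pd i F) x) (pd j F x) = (\<Sum>l\<in>UNIV. D k i $ l * h x $ l $ j)"
    for i j k
  proof -
    have "nabla k (pd i F) x = ?dF (D k i) + P x $ k $ i *\<^sub>R Z x" using D[where i = k and j = i] by (simp add: algebra_simps)
    then show ?thesis
      by (simp add: metric_inner_add metric_inner_scaleR Z_orth[OF x] inner_dF_left[OF x] h_induced[OF x])
  qed
  have metric: "pd k (\<lambda>y. h y $ i $ j) x
      = (\<Sum>l\<in>UNIV. D k i $ l * h x $ l $ j) + (\<Sum>l\<in>UNIV. D k j $ l * h x $ i $ l)" for i j k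
  proof -
    have "pd k (\<lambda>y. h y $ i $ j) x = pd k (\<lambda>y. metric_inner (g (F y)) (pd i F y) (pd j F y)) x"
      by (rule pd_cong_open[OF open_U x h_induced])
    also have "\<dots> = metric_inner (g (F x)) (nabla k (pd i F) x) (pd j F x)
        + metric_inner (g (F x)) (nabla k (pd j F) x) (pd i F x)"
      using pd_metric_inner[OF x pd_F_diff[OF x] pd_F_diff[OF x]]
        metric_inner_commute[OF sym_g[OF F_in[OF x]]] by simp
    finally have "pd k (\<lambda>y. h y $ i $ j) x
      = (\<Sum>l\<in>UNIV. D k i $ l * h x $ l $ j) + (\<Sum>l\<in>UNIV. D k j $ l * h x $ l $ i)"
      unfolding inner .
    moreover have "h x $ l $ i = h x $ i $ l" for l
      using arg_cong[OF sym_h[OF x], of "\<lambda>G. G $ i $ l"] by (simp add: transpose_def)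
    ultimately show ?thesis by simp
  qed
  have "D i j $ k = christoffel h x i j k" for k
    using christoffel_iff_levi_civita[where h = h and G = "\<lambda>i j k. D i j $ k", OF open_U x sym_h inv_h[OF x]]
      torsion metric by auto
  then have "D i j = intrinsic.nabla i (\<lambda>_. axis j 1) x"
    by (simp add: intrinsic_nabla_axis vec_eq_iff)
  then show ?thesis using D[where i = i and j = j] by (simp add: algebra_simps)
qed

lemma inner_nabla_tangent:
  "x \<in> U \<Longrightarrow> metric_inner (g (F x)) (nabla j (pd k F) x) (pd l F x)
    = metric_inner (h x) (intrinsic.nabla j (\<lambda>_. axis k 1) x) (axis l 1)"
  using inner_dF_dF[of x "intrinsic.nabla j (\<lambda>_. axis k 1) x" "axis l 1"]
  by (simp add: Gauss_formula metric_inner_add metric_inner_scaleR Z_dF pd_def)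

lemma inner_nabla_normal:
  "x \<in> U \<Longrightarrow> metric_inner (g (F x)) (nabla j (pd k F) x) (Z x) = \<epsilon> * P x $ j $ k"
  by (simp add: Gauss_formula metric_inner_add metric_inner_scaleR Z_dF Z_unit)

lemma inner_nabla_nabla:
  assumes "x \<in> U"
  shows "metric_inner (g (F x)) (nabla j (pd k F) x) (nabla i (pd l F) x)
    = metric_inner (h x) (intrinsic.nabla j (\<lambda>_. axis k 1) x) (intrinsic.nabla i (\<lambda>_. axis l 1) x)
      + \<epsilon> * P x $ j $ k * P x $ i $ l"
  using assms by (simp add: Gauss_formula metric_inner_add metric_inner_scaleR Z_dF Z_unit inner_dF_dF)

text \<open>Both sides are given by \<open>Riem_form_along\<close>: the ambient one for the frame \<open>\<partial>\<^sub>kF\<close> along \<open>F\<close>, the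
  intrinsic one for the constant frame along the identity. The scalar functions that get
  differentiated coincide, and the inner products of covariant derivatives differ by the product
  \<open>\<epsilon> P\<^sub>j\<^sub>k P\<^sub>i\<^sub>l\<close> of the normal parts.\<close>

lemma Gauss_equation:
  assumes x: "x \<in> U"
  shows "Riem_form g (F x) (pd i F x) (pd j F x) (pd k F x) (pd l F x)
    = Riem h x i j k l + \<epsilon> * owedge (P x) i j k l"
proof -
  have pd_id: "pd i (\<lambda>y. y) x = axis i 1" for i :: 'n by (simp add: pd_def frechet_derivative_ident)
  have pd_eq: "pd i (\<lambda>y. metric_inner (g (F y)) (nabla j (pd k F) y) (pd l F y)) x
    = pd i (\<lambda>y. metric_inner (h y) (intrinsic.nabla j (\<lambda>_. axis k 1) y) (axis l 1)) x" for i j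
    by (rule pd_cong_open[OF open_U x inner_nabla_tangent])
  have "Riem h x i j k l
    = (pd i (\<lambda>y. metric_inner (h y) (intrinsic.nabla j (\<lambda>_. axis k 1) y) (axis l 1)) x
        - metric_inner (h x) (intrinsic.nabla j (\<lambda>_. axis k 1) x) (intrinsic.nabla i (\<lambda>_. axis l 1) x))
    - (pd j (\<lambda>y. metric_inner (h y) (intrinsic.nabla i (\<lambda>_. axis k 1) y) (axis l 1)) x
        - metric_inner (h x) (intrinsic.nabla i (\<lambda>_. axis k 1) x) (intrinsic.nabla j (\<lambda>_. axis l 1) x))"
    using intrinsic.Riem_form_along[OF x smooth_on_const smooth_on_const, of i j "axis k 1" "axis l 1"]
    by (simp only: pd_id Riem_form_axis)
  moreover have "P x $ k $ i = P x $ i $ k" "P x $ k $ j = P x $ j $ k"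
    using sym_P[OF x] by blast+
  ultimately show ?thesis
    using Riem_form_along[OF x smooth_on_pd[OF smooth_F] smooth_on_pd[OF smooth_F], of i j k l]
    by (simp add: pd_eq inner_nabla_nabla[OF x] owedge_def algebra_simps)
qed

text \<open>Differentiate the constant functions \<open>\<langle>\<partial>\<^sub>pF, Z\<rangle> = 0\<close> and \<open>\<langle>Z, Z\<rangle> = \<epsilon>\<close>.\<close>

lemma Weingarten:
  assumes x: "x \<in> U"
  shows "metric_inner (g (F x)) (pd p F x) (nabla i Z x) = - \<epsilon> * P x $ i $ p"
    and "metric_inner (g (F x)) (Z x) (nabla i Z x) = 0"
proof -
  note comm = metric_inner_commute[OF sym_g[OF F_in]]
  have dZ: "Z differentiable (at x)" by (rule smooth_on_differentiable[OF smooth_Z x])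
  have "pd i (\<lambda>y. metric_inner (g (F y)) (pd p F y) (Z y)) x = pd i (\<lambda>y. 0::real) x"
    by (rule pd_cong_open[OF open_U x]) (use Z_orth comm in metis)
  then show "metric_inner (g (F x)) (pd p F x) (nabla i Z x) = - \<epsilon> * P x $ i $ p"
    using pd_metric_inner[OF x pd_F_diff[OF x] dZ] inner_nabla_normal[OF x] by simp
  have "pd i (\<lambda>y. metric_inner (g (F y)) (Z y) (Z y)) x = pd i (\<lambda>y. \<epsilon>) x"
    by (rule pd_cong_open[OF open_U x Z_unit])
  then show "metric_inner (g (F x)) (Z x) (nabla i Z x) = 0"
    using pd_metric_inner[OF x dZ dZ, of i] comm[OF x, of "Z x"] by simp
qed

text \<open>The same curvature identity with \<open>Z\<close> as the second field. The differentiated functions are now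
  \<open>\<epsilon> P\<^sub>j\<^sub>k\<close>, the Weingarten equations supply one Christoffel correction in each of
  \<open>D\<^sub>i P\<^sub>j\<^sub>k\<close> and \<open>D\<^sub>j P\<^sub>i\<^sub>k\<close>, and the other correction is the same in both.\<close>

lemma Codazzi_equation:
  assumes x: "x \<in> U"
  shows "Riem_form g (F x) (pd i F x) (pd j F x) (pd k F x) (Z x)
    = \<epsilon> * (cov2 h P x i j k - cov2 h P x j i k)"
proof -
  have dP: "(\<lambda>y. P y $ j $ k) differentiable (at x)" for j k
    by (intro differentiable_nth smooth_on_differentiable[OF smooth_P x])
  have pd_eq: "pd i (\<lambda>y. metric_inner (g (F y)) (nabla j (pd k F) y) (Z y)) x
    = \<epsilon> * pd i (\<lambda>y. P y $ j $ k) x" for i j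
  proof -
    have "pd i (\<lambda>y. metric_inner (g (F y)) (nabla j (pd k F) y) (Z y)) x = pd i (\<lambda>y. \<epsilon> * P y $ j $ k) x"
      by (rule pd_cong_open[OF open_U x inner_nabla_normal])
    then show ?thesis by (simp add: pd_mult dP)
  qed
  have "metric_inner (g (F x)) (nabla j (pd k F) x) (nabla i Z x)
     = - \<epsilon> * (\<Sum>p\<in>UNIV. christoffel h x j k p * P x $ i $ p)" for i j
    by (simp add: Gauss_formula[OF x] metric_inner_add metric_inner_scaleR inner_dF_left[OF x]
        Weingarten[OF x] intrinsic_nabla_axis sum_distrib_left sum_negf mult_ac)
  then show ?thesis
    using Riem_form_along[OF x smooth_on_pd[OF smooth_F] smooth_Z, of i j k]
    by (simp add: pd_eq cov2_def intrinsic.christoffel_sym[OF x, of i j] algebra_simps)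
qed

end

section \<open>The scalar curvature of a minimal hypersurface\<close>

text \<open>Contracting the Gauss equation twice: the term \<open>h \<circledast> h\<close> contributes \<open>n - n\<^sup>2\<close>, and \<open>P \<circledast> P\<close>
  contributes \<open>|P|\<^sup>2 - (tr P)\<^sup>2\<close>, whose second part vanishes.\<close>

lemma scal_minimal_Gauss:
  fixes h :: "real^'n::finite \<Rightarrow> real^'n^'n" and P :: "real^'n^'n"
  assumes inv: "invertible (h x)" and sym: "transpose (h x) = h x" "transpose P = P"
    and trace: "trace_wrt (h x) P = 0"
    and Riem: "\<And>i j k l. Riem h x i j k l = K * owedge (h x) i j k l - \<epsilon> * owedge P i j k l"
  shows "scal h x = - K * (real CARD('n) * (real CARD('n) - 1)) - \<epsilon> * sq_norm_wrt (h x) P"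
proof -
  define H where "H = matrix_inv (h x)"
  have hs: "h x $ i $ j = h x $ j $ i" for i j
    using arg_cong[OF sym(1), of "\<lambda>G. G $ j $ i"] by (simp add: transpose_def)
  have Ps: "P $ i $ j = P $ j $ i" for i j
    using arg_cong[OF sym(2), of "\<lambda>G. G $ j $ i"] by (simp add: transpose_def)
  have hH: "(\<Sum>l\<in>UNIV. h x $ i $ l * H $ l $ p) = (if i = p then 1 else 0)" for i p
    using arg_cong[OF matrix_inv_both(1)[OF inv], of "\<lambda>M. M $ i $ p"]
    by (simp add: H_def matrix_matrix_mult_def mat_def)
  have Hh: "(\<Sum>l\<in>UNIV. H $ i $ l * h x $ l $ p) = (if i = p then 1 else 0)" for i p
    using arg_cong[OF matrix_inv_both(2)[OF inv], of "\<lambda>M. M $ i $ p"]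
    by (simp add: H_def matrix_matrix_mult_def mat_def)
  have curv: "curv h x i j k p = (\<Sum>l\<in>UNIV. Riem h x i j k l * H $ l $ p)" for i j k p
  proof -
    have "(\<Sum>l\<in>UNIV. Riem h x i j k l * H $ l $ p)
       = (\<Sum>l\<in>UNIV. \<Sum>q\<in>UNIV. curv h x i j k q * (h x $ q $ l * H $ l $ p))"
      by (simp add: Riem_def sum_distrib_right mult.assoc)
    also have "\<dots> = (\<Sum>q\<in>UNIV. curv h x i j k q * (\<Sum>l\<in>UNIV. h x $ q $ l * H $ l $ p))"
      by (subst sum.swap) (simp add: sum_distrib_left)
    also have "\<dots> = curv h x i j k p" by (simp add: hH if_distrib cong: if_cong)
    finally show ?thesis by simp
  qed
  \<comment> \<open>The double contraction that produces the scalar curvature, where \<open>t i j p l\<close>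
    stands in the place of \<open>Riem\<^sub>p\<^sub>i\<^sub>j\<^sub>l\<close>.\<close>
  define S where "S t = (\<Sum>i\<in>UNIV. \<Sum>j\<in>UNIV. \<Sum>p\<in>UNIV. \<Sum>l\<in>UNIV. H $ i $ j * H $ l $ p * t i j p l)"
    for t :: "'n \<Rightarrow> 'n \<Rightarrow> 'n \<Rightarrow> 'n \<Rightarrow> real"
  have S_lin: "S (\<lambda>i j p l. a * (t i j p l - t' i j p l) - b * (s i j p l - s' i j p l))
      = a * (S t - S t') - b * (S s - S s')" for a b t t' s s'
    unfolding S_def by (simp add: sum_subtractf sum.distrib sum_distrib_left algebra_simps)
  have "scal h x = S (\<lambda>i j p l. Riem h x p i j l)"
    unfolding scal_def Ric_def curv S_def H_def[symmetric] by (simp add: sum_distrib_left mult_ac)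
  also have "\<dots> = K * (S (\<lambda>i j p l. h x $ j $ p * h x $ i $ l) - S (\<lambda>i j p l. h x $ j $ i * h x $ p $ l))
      - \<epsilon> * (S (\<lambda>i j p l. P $ j $ p * P $ i $ l) - S (\<lambda>i j p l. P $ j $ i * P $ p $ l))"
    unfolding Riem owedge_def S_lin ..
  also have "S (\<lambda>i j p l. h x $ j $ p * h x $ i $ l) = real CARD('n)"
  proof -
    have "S (\<lambda>i j p l. h x $ j $ p * h x $ i $ l) = (\<Sum>i\<in>UNIV. \<Sum>j\<in>UNIV. \<Sum>p\<in>UNIV.
        H $ i $ j * h x $ j $ p * (\<Sum>l\<in>UNIV. h x $ i $ l * H $ l $ p))"
      unfolding S_def sum_distrib_left by (simp add: mult_ac)
    also have "\<dots> = (\<Sum>i\<in>UNIV. \<Sum>j\<in>UNIV. H $ i $ j * h x $ j $ i)"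
      by (simp add: hH if_distrib cong: if_cong)
    finally show ?thesis by (simp add: Hh)
  qed
  also have "S (\<lambda>i j p l. h x $ j $ i * h x $ p $ l) = real CARD('n) * real CARD('n)"
  proof -
    have "S (\<lambda>i j p l. h x $ j $ i * h x $ p $ l)
      = (\<Sum>i\<in>UNIV. \<Sum>j\<in>UNIV. H $ i $ j * h x $ j $ i) * (\<Sum>p\<in>UNIV. \<Sum>l\<in>UNIV. h x $ p $ l * H $ l $ p)"
      unfolding S_def sum_distrib_right unfolding sum_distrib_left by (simp add: mult_ac)
    then show ?thesis by (simp add: Hh hH)
  qed
  also have "S (\<lambda>i j p l. P $ j $ p * P $ i $ l) = sq_norm_wrt (h x) P"
  proof -
    let ?t = "\<lambda>i j p l. H $ i $ j * H $ l $ p * (P $ j $ p * P $ i $ l)"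
    have "(\<Sum>i\<in>UNIV. \<Sum>j\<in>UNIV. \<Sum>p\<in>UNIV. \<Sum>l\<in>UNIV. ?t i j p l)
        = (\<Sum>i\<in>UNIV. \<Sum>j\<in>UNIV. \<Sum>l\<in>UNIV. \<Sum>p\<in>UNIV. ?t i j p l)" by (intro sum.cong refl sum.swap)
    also have "\<dots> = (\<Sum>i\<in>UNIV. \<Sum>l\<in>UNIV. \<Sum>j\<in>UNIV. \<Sum>p\<in>UNIV. ?t i j p l)" by (intro sum.cong refl sum.swap)
    finally show ?thesis unfolding S_def sq_norm_wrt_def H_def[symmetric] by (simp only: mult.assoc)
  qed
  also have "S (\<lambda>i j p l. P $ j $ i * P $ p $ l) = 0"
  proof -
    have "S (\<lambda>i j p l. P $ j $ i * P $ p $ l)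
      = (\<Sum>i\<in>UNIV. \<Sum>j\<in>UNIV. H $ i $ j * P $ j $ i) * (\<Sum>p\<in>UNIV. \<Sum>l\<in>UNIV. P $ p $ l * H $ l $ p)"
      unfolding S_def sum_distrib_right unfolding sum_distrib_left by (simp add: mult_ac)
    moreover have "(\<Sum>i\<in>UNIV. \<Sum>j\<in>UNIV. H $ i $ j * P $ j $ i) = trace_wrt (h x) P"
      unfolding trace_wrt_def H_def by (subst Ps) (rule refl)
    ultimately show ?thesis using trace by simp
  qed
  finally show ?thesis by (simp add: algebra_simps)
qed

section \<open>The induced metric\<close>

lemma chart_around_image:
  assumes "smooth_manifold M A" "smooth_manifold N B" "continuous_map M N f" "c \<in> A" "x \<in> chart_img c"
  obtains d where "d \<in> B" "x \<in> rep_dom c d f"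
proof -
  have p: "param c x \<in> chart_dom c" using rep_dom_param(4)[OF assms(1,4)] assms(5) by blast
  have "openin M (chart_dom c)" using assms(1,4) unfolding smooth_manifold_def by blast
  then have "param c x \<in> topspace M" using p openin_subset by blast
  then have "f (param c x) \<in> topspace N" using continuous_map_image_subset_topspace[OF assms(3)] by blast
  moreover have "\<Union> (chart_dom ` B) = topspace N" using assms(2) unfolding smooth_manifold_def by blast
  ultimately obtain d where "d \<in> B" "f (param c x) \<in> chart_dom d" by blast
  then show thesis using that rep_dom_param(3)[OF assms(1,4), of x d f] assms(5) by blast
qed

text \<open>In a target chart the pullback is \<open>J\<^sup>T (g \<circ> F) J\<close> with \<open>J\<close> the Jacobian of \<open>F\<close>. This is smooth as
  a product of smooth matrix-valued maps, symmetric because \<open>g\<close> is, and it transforms as a tensor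
  by the chain rule, once the same target chart is used for both source charts.\<close>

lemma pullback_sym_tensor2:
  assumes M: "smooth_manifold M A" and N: "smooth_manifold N B" and f: "smooth_map M A N B f"
    and g: "sym_tensor2 B g"
  shows "sym_tensor2 A (pullback B f g)"
proof -
  note pb = pullback_eq[OF M N f g]
  have cf: "continuous_map M N f" using f by (simp add: smooth_map_def)
  note around = chart_around_image[OF M N cf]
  have sF: "smooth_on (rep_dom c d f) (local_rep c d f)" if "c \<in> A" "d \<in> B" for c d
    using f that by (simp add: smooth_map_def)
  have gsym: "transpose (g d y) = g d y" if "d \<in> B" "y \<in> chart_img d" for d y
    using g that unfolding sym_tensor2_def by blast
  have gsm: "smooth_on (chart_img d) (g d)" if "d \<in> B" for d
    using g that unfolding sym_tensor2_def by blast
  have Fin: "local_rep c d f x \<in> chart_img d" if "c \<in> A" "x \<in> rep_dom c d f" for c d x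
    using that rep_dom_param(3)[OF M that(1), of x d f] by (simp add: local_rep_def chart_img_def)
  have smooth: "smooth_on (chart_img c) (pullback B f g c)" if c: "c \<in> A" for c
    unfolding smooth_on_def
  proof
    fix k
    show "Ck_on k (chart_img c) (pullback B f g c)"
    proof (rule Ck_on_local)
      show "open (chart_img c)" using M c unfolding smooth_manifold_def by blast
    next
      fix x assume "x \<in> chart_img c"
      then obtain d where d: "d \<in> B" "x \<in> rep_dom c d f" using around[OF c] by blast
      let ?U = "rep_dom c d f" and ?F = "local_rep c d f"
      have o: "open ?U" by (rule open_rep_dom[OF M N cf c d(1)])
      have J: "Ck_on k ?U (\<lambda>x. jacobian ?F (at x))"
        using smooth_on_jacobian[OF o sF[OF c d(1)]] by (simp add: smooth_on_def)
      have G: "Ck_on k ?U (\<lambda>x. g d (?F x))"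
      proof (rule Ck_on_compose[OF o _ sF[OF c d(1)]])
        show "?F ` ?U \<subseteq> chart_img d" using Fin[OF c] by blast
        show "Ck_on k (chart_img d) (g d)" using gsm[OF d(1)] by (simp add: smooth_on_def)
      qed
      have "Ck_on k ?U (\<lambda>x. transpose (jacobian ?F (at x)) ** g d (?F x) ** jacobian ?F (at x))"
        by (intro Ck_on_bilinear[OF bounded_bilinear_matrix_mult o]
            Ck_on_bounded_linear[OF bounded_linear_transpose o] J G)
      moreover have "?U \<subseteq> chart_img c" using rep_dom_param(3)[OF M c, of _ d f] by blast
      ultimately show "\<exists>T u. open T \<and> x \<in> T \<and> T \<subseteq> chart_img c \<and> Ck_on k T u
          \<and> (\<forall>y\<in>T. pullback B f g c y = u y)"
        using o d(2) pb[OF c d(1)] by blast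
    qed
  qed
  have symm: "transpose (pullback B f g c x) = pullback B f g c x" if c: "c \<in> A" and x: "x \<in> chart_img c" for c x
  proof -
    obtain d where d: "d \<in> B" "x \<in> rep_dom c d f" using around[OF c x] by blast
    show ?thesis
      by (simp add: pb[OF c d] matrix_transpose_mul gsym[OF d(1) Fin[OF c d(2)]] matrix_mul_assoc)
  qed
  have trafo: "pullback B f g c x = transpose (jacobian (local_rep c c' id) (at x))
        ** pullback B f g c' (local_rep c c' id x) ** jacobian (local_rep c c' id) (at x)"
    if c: "c \<in> A" and c': "c' \<in> A" and x: "x \<in> rep_dom c c' id" for c c' x
  proof -
    let ?T = "local_rep c c' id"
    have xc: "x \<in> chart_img c" "param c x \<in> chart_dom c'" using x rep_dom_param(3)[OF M c, of x c' id] by auto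
    then obtain d where d: "d \<in> B" "x \<in> rep_dom c d f" using around[OF c] by blast
    let ?F = "local_rep c d f" and ?E = "local_rep c' d f"
    have par: "param c' (?T y) = param c y" if "y \<in> rep_dom c c' id" for y
      using that rep_dom_param(3)[OF M c, of y c' id] rep_dom_param(2)[OF M c'] by (simp add: local_rep_def)
    have Tx: "?T x \<in> rep_dom c' d f"
      using d(2) xc rep_dom_param(3)[OF M c, of x d f] by (auto simp: local_rep_def rep_dom_def)
    have ET: "?E (?T y) = ?F y" if "y \<in> rep_dom c c' id" for y
      using par[OF that] by (simp add: local_rep_def)
    have dT: "?T differentiable (at x)"
    proof -
      have "\<forall>c\<in>A. \<forall>c'\<in>A. smooth_on (rep_dom c c' id) (local_rep c c' id)"
        using M unfolding smooth_manifold_def by (elim conjE)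
      then show ?thesis using c c' x smooth_on_differentiable by blast
    qed
    have dE: "?E differentiable (at (?T x))"
      using smooth_on_differentiable[OF sF[OF c' d(1)] Tx] .
    have o: "open (rep_dom c c' id)" by (rule open_rep_dom[OF M M _ c c']) simp
    have "((\<lambda>y. ?E (?T y)) has_derivative (\<lambda>v. jacobian ?E (at (?T x)) *v (jacobian ?T (at x) *v v))) (at x)"
      by (rule has_derivative_compose[OF dT[unfolded jacobian_works] dE[unfolded jacobian_works]])
    then have "(?F has_derivative (\<lambda>v. (jacobian ?E (at (?T x)) ** jacobian ?T (at x)) *v v)) (at x)"
      unfolding matrix_vector_mul_assoc
      by (rule has_derivative_transform_within_open[OF _ o x ET])
    then have J: "jacobian ?F (at x) = jacobian ?E (at (?T x)) ** jacobian ?T (at x)"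
      by (simp add: jacobian_def[of ?F] frechet_derivative_at[symmetric])
    show ?thesis
      by (simp add: pb[OF c d] pb[OF c' d(1) Tx] J ET[OF x] matrix_transpose_mul matrix_mul_assoc)
  qed
  show ?thesis unfolding sym_tensor2_def using smooth symm trafo by blast
qed

lemma pullback_nth:
  assumes M: "smooth_manifold M A" and N: "smooth_manifold N B" and f: "smooth_map M A N B f"
    and g: "sym_tensor2 B g" and c: "c \<in> A" and d: "d \<in> B" and x: "x \<in> rep_dom c d f"
  shows "pullback B f g c x $ i $ j = metric_inner (g d (local_rep c d f x))
     (pd i (local_rep c d f) x) (pd j (local_rep c d f) x)"
proof -
  let ?J = "jacobian (local_rep c d f) (at x)" and ?G = "g d (local_rep c d f x)"
  have J: "?J $ a $ i = pd i (local_rep c d f) x $ a" for a i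
    by (simp add: jacobian_def matrix_def pd_def)
  have "(transpose ?J ** ?G ** ?J) $ i $ j = (\<Sum>b\<in>UNIV. \<Sum>a\<in>UNIV. ?J $ a $ i * ?G $ a $ b * ?J $ b $ j)"
    by (simp add: matrix_matrix_mult_def transpose_def sum_distrib_right)
  then show ?thesis
    unfolding pullback_eq[OF assms] metric_inner_sum J by (subst sum.swap) simp
qed

section \<open>Minimal hypersurfaces of space forms\<close>

text \<open>The second fundamental form is characterised through arbitrary vector fields; inserting the
  coordinate fields yields the tangency assumption on \<open>\<nabla>\<^sub>i \<partial>\<^sub>jF\<close>.\<close>

lemma hypersurface_in_charts:
  assumes M: "smooth_manifold M A" and N: "smooth_manifold N B" and g: "pseudo_riemannian_metric B g"
    and f: "immersion M A N B f" and nd: "nondegenerate A (pullback B f g)"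
    and Z: "vector_field_along A B f Z" and orth: "orthogonal_along A B f g Z"
    and unit: "sq_length_along A B f g Z \<epsilon>" and P: "second_fundamental_form A B f g Z P"
    and c: "c \<in> A" and d: "d \<in> B"
  shows "nondegenerate_hypersurface (rep_dom c d f) (local_rep c d f) (chart_img d) (g d)
    (pullback B f g c) (P c) (\<lambda>x. Z d (param c x)) \<epsilon>"
proof -
  let ?U = "rep_dom c d f" and ?F = "local_rep c d f"
  have sf: "smooth_map M A N B f" and inj: "\<And>x. x \<in> ?U \<Longrightarrow> inj (frechet_derivative ?F (at x))"
    using f c d unfolding immersion_def by blast+
  have cf: "continuous_map M N f" and sF: "smooth_on ?U ?F"
    using sf c d unfolding smooth_map_def by blast+
  have gt: "sym_tensor2 B g" using g by (simp add: pseudo_riemannian_metric_def)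
  have U: "x \<in> chart_img c" "?F x \<in> chart_img d" if "x \<in> ?U" for x
    using that rep_dom_param(3)[OF M c, of x d f] by (simp_all add: local_rep_def chart_img_def)
  have sub: "?U \<subseteq> chart_img c" using U by blast
  have Pt: "sym_tensor2 A P" using P by (simp add: second_fundamental_form_def)
  have Psym: "transpose (P c x) = P c x" if "x \<in> ?U" for x
    using Pt c U(1)[OF that] unfolding sym_tensor2_def by blast
  have dF: "frechet_derivative ?F (at x) (axis i 1) = pd i ?F x" for i x by (simp add: pd_def)
  show ?thesis
  proof
    show "open ?U" by (rule open_rep_dom[OF M N cf c d])
    show "open (chart_img d)" using N d unfolding smooth_manifold_def by blast
    show "smooth_on ?U ?F" by (rule sF)
    show "?F x \<in> chart_img d" if "x \<in> ?U" for x using U that by blast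
    show "smooth_on (chart_img d) (g d)" "\<And>y. y \<in> chart_img d \<Longrightarrow> transpose (g d y) = g d y"
      using gt d unfolding sym_tensor2_def by blast+
    show "invertible (g d y)" if "y \<in> chart_img d" for y
      using g d that unfolding pseudo_riemannian_metric_def nondegenerate_def by blast
    show "smooth_on ?U (pullback B f g c)"
      using pullback_sym_tensor2[OF M N sf gt] c smooth_on_subset[OF _ sub] unfolding sym_tensor2_def by blast
    show "invertible (pullback B f g c x)" if "x \<in> ?U" for x
      using nd c U that unfolding nondegenerate_def by blast
    show "pullback B f g c x $ i $ j = metric_inner (g d (?F x)) (pd i ?F x) (pd j ?F x)"
      if "x \<in> ?U" for x i j by (rule pullback_nth[OF M N sf gt c d that])
    show "inj (frechet_derivative ?F (at x))" if "x \<in> ?U" for x by (rule inj[OF that])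
    show "smooth_on ?U (P c)"
      using Pt c smooth_on_subset[OF _ sub] unfolding sym_tensor2_def by blast
    show "P c x $ i $ j = P c x $ j $ i" if "x \<in> ?U" for x i j
      using arg_cong[OF Psym[OF that], of "\<lambda>G. G $ j $ i"] by (simp add: transpose_def)
    show "smooth_on ?U (\<lambda>x. Z d (param c x))" using Z c d unfolding vector_field_along_def by blast
    show "metric_inner (g d (?F x)) (Z d (param c x)) (pd i ?F x) = 0" if "x \<in> ?U" for x i
      using orth c d that unfolding orthogonal_along_def pd_def by blast
    show "metric_inner (g d (?F x)) (Z d (param c x)) (Z d (param c x)) = \<epsilon>" if "x \<in> ?U" for x
      using unit c d that unfolding sq_length_along_def by blast
    show "cov_along (g d) ?F (pd j ?F) x (axis i 1) - P c x $ i $ j *\<^sub>R Z d (param c x)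
        \<in> range (frechet_derivative ?F (at x))" if x: "x \<in> ?U" for x i j
    proof -
      have all: "\<forall>X Y. smooth_on ?U X \<longrightarrow> smooth_on ?U Y \<longrightarrow> (\<forall>x\<in>?U.
         normal_projection (g d (?F x)) (range (frechet_derivative ?F (at x)))
           (cov_along (g d) ?F (\<lambda>y. frechet_derivative ?F (at y) (Y y)) x (X x))
           (metric_inner (P c x) (X x) (Y x) *\<^sub>R Z d (param c x)))"
        using P c d unfolding second_fundamental_form_def Let_def by blast
      have "normal_projection (g d (?F x)) (range (frechet_derivative ?F (at x)))
         (cov_along (g d) ?F (\<lambda>y. frechet_derivative ?F (at y) (axis j 1)) x (axis i 1))
         (metric_inner (P c x) (axis i 1) (axis j 1) *\<^sub>R Z d (param c x))"
        by (rule bspec[OF all[rule_format, of "\<lambda>_. axis i 1" "\<lambda>_. axis j 1", THEN ballI] x]) simp_all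
      then show ?thesis unfolding normal_projection_def metric_inner_axis_axis dF by simp
    qed
  qed
qed

theorem theorem4p1:
  fixes M :: "'a topology" and A :: "('a, 'n::finite) chart set"
    and N :: "'b topology" and B :: "('b, 'm::finite) chart set"
    and f :: "'a \<Rightarrow> 'b"
    and g :: "('b, 'm) tensor2" and h P :: "('a, 'n) tensor2"
    and Z :: "('b, 'm) chart \<Rightarrow> 'a \<Rightarrow> real^'m"
    and R\<^sub>g \<epsilon> :: real
  assumes "CARD('n) \<ge> 2" and "CARD('m) = CARD('n) + 1"
    and "smooth_manifold M A" and "smooth_manifold N B"
    and "pseudo_riemannian_metric B g"
    and "\<forall>d\<in>B. \<forall>y\<in>chart_img d. scal (g d) y = R\<^sub>g"
    and "\<forall>d\<in>B. \<forall>y\<in>chart_img d. \<forall>i j k l. Riem (g d) y i j k l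
           = - (R\<^sub>g / (real CARD('n) * (real CARD('n) + 1))) * owedge (g d y) i j k l"
    and "immersion M A N B f"
    and "h = pullback B f g" and "nondegenerate A h"
    and "vector_field_along A B f Z" and "transverse_along A B f Z"
    and "orthogonal_along A B f g Z"
    and "\<epsilon> \<in> {1, -1}" and "sq_length_along A B f g Z \<epsilon>"
    and "second_fundamental_form A B f g Z P"
    and "\<forall>c\<in>A. \<forall>x\<in>chart_img c. trace_wrt (h c x) (P c x) = 0"
  shows "coupled_projectively_flat A h P (- \<epsilon>) ((real CARD('n) - 1) / (real CARD('n) + 1) * R\<^sub>g)
    \<and> (\<forall>c\<in>A. \<forall>x\<in>chart_img c. scal (h c) x + \<epsilon> * sq_norm_wrt (h c x) (P c x)
          = (real CARD('n) - 1) / (real CARD('n) + 1) * R\<^sub>g)"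
proof -
  let ?n = "real CARD('n)"
  let ?K = "- (R\<^sub>g / (?n * (?n + 1)))" and ?\<kappa> = "(?n - 1) / (?n + 1) * R\<^sub>g"
  note M = assms(3) and N = assms(4)
  have sf: "smooth_map M A N B f" using assms(8) by (simp add: immersion_def)
  have cf: "continuous_map M N f" using sf by (simp add: smooth_map_def)
  have n: "?n \<ge> 2" using assms(1) by linarith
  then have nz: "?n - 1 \<noteq> 0" "?n + 1 \<noteq> 0" "?n \<noteq> 0" by linarith+
  have "- ((m - 1) / (m + 1) * R\<^sub>g / (m * (m - 1))) = - (R\<^sub>g / (m * (m + 1)))
      \<and> R\<^sub>g / (m * (m + 1)) * (m * (m - 1)) = (m - 1) / (m + 1) * R\<^sub>g"
    if "m - 1 \<noteq> 0" "m + 1 \<noteq> 0" "m \<noteq> 0" for m :: real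
    using that by (simp add: divide_simps)
  from this[OF nz] have K: "- (?\<kappa> / (?n * (?n - 1))) = ?K" and \<kappa>: "- ?K * (?n * (?n - 1)) = ?\<kappa>"
    by simp_all
  have ht: "sym_tensor2 A h"
    using pullback_sym_tensor2[OF M N sf] assms(5,9) by (simp add: pseudo_riemannian_metric_def)
  have Pt: "sym_tensor2 A P" using assms(16) by (simp add: second_fundamental_form_def)
  have eqs: "Riem (h c) x i j k l = ?K * owedge (h c x) i j k l - \<epsilon> * owedge (P c x) i j k l
      \<and> cov2 (h c) (P c) x i j k = cov2 (h c) (P c) x j i k"
    if c: "c \<in> A" and x: "x \<in> chart_img c" for c x i j k l
  proof -
    obtain d where d: "d \<in> B" "x \<in> rep_dom c d f" by (rule chart_around_image[OF M N cf c x])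
    let ?F = "local_rep c d f"
    interpret nondegenerate_hypersurface "rep_dom c d f" ?F "chart_img d" "g d"
        "h c" "P c" "\<lambda>x. Z d (param c x)" \<epsilon>
      using hypersurface_in_charts[OF M N assms(5,8) _ assms(11,13,15,16) c d(1)] assms(9,10) by simp
    note y = F_in[OF d(2)]
    have cc: "Riem (g d) (?F x) i j k l = ?K * owedge (g d (?F x)) i j k l" for i j k l
      using assms(7) d(1) y by blast
    note form = Riem_form_constant_curvature[OF sym_g[OF y] cc]
    have "Riem (h c) x i j k l + \<epsilon> * owedge (P c x) i j k l = ?K * owedge (h c x) i j k l"
      using Gauss_equation[OF d(2), of i j k l] unfolding form owedge_def[of "h c x"]
      by (simp add: h_induced[OF d(2)])
    moreover have "\<epsilon> * (cov2 (h c) (P c) x i j k - cov2 (h c) (P c) x j i k) = 0"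
      using Codazzi_equation[OF d(2), of i j k]
        metric_inner_commute[OF sym_g[OF y], of "pd _ ?F x" "Z d (param c x)"]
      unfolding form by (simp add: Z_orth[OF d(2)])
    ultimately show ?thesis using assms(14) by auto
  qed
  have scal: "scal (h c) x + \<epsilon> * sq_norm_wrt (h c x) (P c x) = ?\<kappa>"
    if c: "c \<in> A" and x: "x \<in> chart_img c" for c x
  proof -
    have "scal (h c) x = - ?K * (?n * (?n - 1)) - \<epsilon> * sq_norm_wrt (h c x) (P c x)"
    proof (rule scal_minimal_Gauss)
      show "invertible (h c x)" using assms(10) that unfolding nondegenerate_def by blast
      show "transpose (h c x) = h c x" using ht that unfolding sym_tensor2_def by blast
      show "transpose (P c x) = P c x" using Pt that unfolding sym_tensor2_def by blast
      show "trace_wrt (h c x) (P c x) = 0" using assms(17) that by blast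
    qed (use eqs[OF that] in blast)
    then show ?thesis using \<kappa> by linarith
  qed
  have "coupled_projectively_flat A h P (- \<epsilon>) ?\<kappa>"
    unfolding coupled_projectively_flat_def pseudo_riemannian_metric_def K
  proof (intro conjI ballI allI)
    show "sym_tensor2 A h" "nondegenerate A h" "sym_tensor2 A P" using ht assms(10) Pt by blast+
  next
    fix c x assume c: "c \<in> A" and x: "x \<in> chart_img c"
    show "trace_wrt (h c x) (P c x) = 0" using assms(17) c x by blast
    show "cov2 (h c) (P c) x i j k = cov2 (h c) (P c) x j i k" for i j k using eqs[OF c x] by blast
    show "Riem (h c) x i j k l - - \<epsilon> * owedge (P c x) i j k l = ?K * owedge (h c x) i j k l" for i j k l
      using eqs[OF c x, of i j k l] by simp
  qed
  then show ?thesis using scal by blast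
qed

end
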